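(* Let $\alpha,\theta_d,L_d$ be fixed real parameters and, for $\epsilon>0$ small, let $\widetilde{\omega}=\widetilde{\omega}(\epsilon)=1-\frac{\theta_d^2}{2}\epsilon^2$. Let $(L(\tau^+),\theta(\tau^+))$ (depending on $\epsilon$) be the solution of $$\widetilde{\omega}^2 L''+\left(1-\widetilde{\omega}^2(\theta')^2\right)L=1-\epsilon^2\cos\theta,\qquad L\theta''+2L'\theta'=\widetilde{\omega}^{-2}\epsilon^2\sin\theta,$$ where prime denotes $d/d\tau^+$, with initial conditions $$\theta(0)=-\alpha,\quad \theta'(0)=\epsilon\,\widetilde{\omega}^{-1}\theta_d,\quad L(0)=1,\quad L'(0)=-\epsilon\,\widetilde{\omega}^{-1}L_d .$$ Define $$\widetilde{L}(\tau^+)=1-\epsilon L_d\sin\tau^+-\epsilon^2\left(\cos\alpha-\theta_d^2\right)\left(1-\cos\tau^+\right),$$ $$\widetilde{\theta}(\tau^+)=-\alpha+\epsilon\theta_d\tau^+-\tfrac12\epsilon^2(\sin\alpha)(\tau^+)^2+2\epsilon^2L_d\theta_d\left(1-\cos\tau^+\right).$$ Then for every fixed $T<\infty$, $$|L(\tau^+)-\widetilde{L}(\tau^+)|=O(\epsilon^3),\qquad |\theta(\tau^+)-\widetilde{\theta}(\tau^+)|=O(\epsilon^3)\qquad\text{as }\epsilon\to0^+,$$ uniformly for $0\le\tau^+\le T$.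
   Context: The system is the nondimensional spring-mass (inverted elastic pendulum) model of running in polar coordinates, $$L\ddot\theta+2\dot L\dot\theta=\sin\theta,\qquad \ddot L-\dot\theta^2L=K(1-L)-\cos\theta,$$ $$\theta(0)=-\alpha,\quad\dot\theta(0)=\theta_d,\quad L(0)=1,\quad\dot L(0)=-L_d,$$ (dot denotes $d/dt$), rewritten with $\epsilon=1/\sqrt{K}$ in the strained fast time $\tau^+=\widetilde{\omega}(\epsilon)\,t/\epsilon$. Here $L$ is the spring length, $\theta$ the angle, and $K$ the stiffness. The parameters $\alpha,\theta_d,L_d$ do not depend on $\epsilon$. *)

theory Defs
  imports "HOL-Analysis.Analysis"
begin

definition strained_freq :: "real \<Rightarrow> real \<Rightarrow> real" where
  "strained_freq \<theta>\<^sub>d \<epsilon> = 1 - \<theta>\<^sub>d\<^sup>2 / 2 * \<epsilon>\<^sup>2"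

text \<open>
  Derivatives are one-sided at the end points of the interval. Positivity of \<open>L\<close> is not part of
  the notion of solution, although the second equation degenerates where \<open>L\<close> vanishes.
\<close>

definition spring_mass_solution ::
    "real \<Rightarrow> real \<Rightarrow> real \<Rightarrow> real \<Rightarrow> real \<Rightarrow> (real \<Rightarrow> real) \<Rightarrow> (real \<Rightarrow> real) \<Rightarrow> bool" where
  "spring_mass_solution \<alpha> \<theta>\<^sub>d L\<^sub>d \<epsilon> T L \<theta> \<longleftrightarrow>
    (let \<omega> = strained_freq \<theta>\<^sub>d \<epsilon> in
     \<exists>L1 L2 \<theta>1 \<theta>2.
       (\<forall>\<tau>\<in>{0..T}.
          (L has_real_derivative L1 \<tau>) (at \<tau> within {0..T}) \<and>
          (L1 has_real_derivative L2 \<tau>) (at \<tau> within {0..T}) \<and>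
          (\<theta> has_real_derivative \<theta>1 \<tau>) (at \<tau> within {0..T}) \<and>
          (\<theta>1 has_real_derivative \<theta>2 \<tau>) (at \<tau> within {0..T}) \<and>
          \<omega>\<^sup>2 * L2 \<tau> + (1 - \<omega>\<^sup>2 * (\<theta>1 \<tau>)\<^sup>2) * L \<tau> = 1 - \<epsilon>\<^sup>2 * cos (\<theta> \<tau>) \<and>
          L \<tau> * \<theta>2 \<tau> + 2 * L1 \<tau> * \<theta>1 \<tau> = \<epsilon>\<^sup>2 / \<omega>\<^sup>2 * sin (\<theta> \<tau>)) \<and>
       \<theta> 0 = - \<alpha> \<and> \<theta>1 0 = \<epsilon> / \<omega> * \<theta>\<^sub>d \<and> L 0 = 1 \<and> L1 0 = - (\<epsilon> / \<omega> * L\<^sub>d))"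

definition L_approx :: "real \<Rightarrow> real \<Rightarrow> real \<Rightarrow> real \<Rightarrow> real \<Rightarrow> real" where
  "L_approx \<alpha> \<theta>\<^sub>d L\<^sub>d \<epsilon> \<tau> =
     1 - \<epsilon> * L\<^sub>d * sin \<tau> - \<epsilon>\<^sup>2 * (cos \<alpha> - \<theta>\<^sub>d\<^sup>2) * (1 - cos \<tau>)"

definition theta_approx :: "real \<Rightarrow> real \<Rightarrow> real \<Rightarrow> real \<Rightarrow> real \<Rightarrow> real" where
  "theta_approx \<alpha> \<theta>\<^sub>d L\<^sub>d \<epsilon> \<tau> =
     - \<alpha> + \<epsilon> * \<theta>\<^sub>d * \<tau> - 1 / 2 * \<epsilon>\<^sup>2 * sin \<alpha> * \<tau>\<^sup>2 + 2 * \<epsilon>\<^sup>2 * L\<^sub>d * \<theta>\<^sub>d * (1 - cos \<tau>)"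

end

theory Submission
  imports Defs "HOL-Library.Landau_Symbols"
begin

text \<open>
  With the angular momentum \<open>p = L\<^sup>2 \<theta>'\<close> the equations read \<open>\<theta>' = p / L\<^sup>2\<close>,
  \<open>p' = (\<epsilon>\<^sup>2 / \<omega>\<^sup>2) L sin \<theta>\<close> and
  \<open>\<omega>\<^sup>2 L'' + (L - 1) = - \<epsilon>\<^sup>2 cos \<theta> + \<omega>\<^sup>2 p\<^sup>2 / L\<^sup>3\<close>, so that \<open>p\<close> varies slowly and \<open>L - 1\<close>
  is an oscillator with forcing of order \<open>\<epsilon>\<^sup>2\<close>. Replacing \<open>L\<close> by its truncation to \<open>[1/2, 3/2]\<close> in
  the nonlinear terms gives a system with global solutions, for which the energy estimate yields
  \<open>L - 1 = O(\<epsilon>)\<close>; hence the truncation is inactive for small \<open>\<epsilon>\<close>. This gives existence, and, applied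
  up to the first exit time from \<open>[1/2, 3/2]\<close>, it shows that every solution of the original system stays
  close to \<open>L = 1\<close>. Reinserting the first-order information into the right-hand sides improves the
  errors to order \<open>\<epsilon>\<^sup>3\<close>.
\<close>

section \<open>Global existence for Lipschitz fields\<close>

text \<open>A Lipschitz constant valid on the whole space lets a single contraction reach the end of
  the interval, so that no continuation of local solutions is required.\<close>

lemma picard_lindelof_global:
  fixes F :: "'a::banach \<Rightarrow> 'a"
  assumes lip: "K-lipschitz_on UNIV F" and T: "0 \<le> T"
  obtains u where "u 0 = x0"
    and "\<And>t. t \<in> {0..T} \<Longrightarrow> (u has_vector_derivative F (u t)) (at t within {0..T})"
proof -
  \<comment> \<open>The fixed point is taken for \<open>v t = exp (- \<mu> t) u t\<close>: in this weighted norm the Picard map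
    contracts on all of \<open>[0, T]\<close>.\<close>
  define \<mu> where "\<mu> = 2 * K + 1"
  have K: "0 \<le> K" using lip lipschitz_on_nonneg by blast
  then have \<mu>: "\<mu> > 0" "2 * K \<le> \<mu>" by (auto simp: \<mu>_def)
  have contF: "continuous_on UNIV F" using lip by (rule lipschitz_on_continuous_on)
  define G where "G v s = F (exp (\<mu> * s) *\<^sub>R v s)" for v :: "real \<Rightarrow> 'a" and s
  define P where "P v t = exp (- \<mu> * t) *\<^sub>R (x0 + integral {0..t} (G v))" for v t
  \<comment> \<open>\<open>clamp\<close> freezes the Picard map outside [0, T]. The result is
    bounded and continuous on the whole line, so the contraction acts on the complete space of
    bounded continuous functions.\<close>
  define \<Phi> where "\<Phi> (v :: real \<Rightarrow>\<^sub>C 'a) = (Bcontfun (\<lambda>t. P v (clamp 0 T t)) :: real \<Rightarrow>\<^sub>C 'a)" for v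
  have contG: "continuous_on S (G v)" for S and v :: "real \<Rightarrow>\<^sub>C 'a"
    unfolding G_def
    by (intro continuous_on_compose2[OF contF] continuous_intros continuous_on_apply_bcontfun) auto
  have contP: "continuous_on (cbox 0 T) (P v)" for v :: "real \<Rightarrow>\<^sub>C 'a"
    unfolding P_def cbox_interval
    by (intro continuous_intros indefinite_integral_continuous_1 integrable_continuous_real contG)
  have \<Phi>: "apply_bcontfun (\<Phi> v) t = P v (clamp 0 T t)" for v t
  proof -
    have "bounded (P v ` cbox 0 T)"
      by (intro compact_imp_bounded compact_continuous_image contP compact_cbox)
    then have "(\<lambda>t. P v (clamp 0 T t)) \<in> bcontfun"
      unfolding bcontfun_def mem_Collect_eq
      by (intro conjI clamp_continuous_on contP clamp_bounded)
    then show ?thesis unfolding \<Phi>_def by (simp add: Bcontfun_inverse)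
  qed
  have contract: "dist (\<Phi> v) (\<Phi> w) \<le> 1/2 * dist v w" for v w
  proof (rule dist_bound)
    fix s
    define t where "t = clamp 0 T s"
    have t: "0 \<le> t" "t \<le> T" using clamp_in_interval[of 0 T s] T unfolding t_def by auto
    define d where "d = dist v w"
    have "d \<ge> 0" by (simp add: d_def)
    have "norm (integral {0..t} (\<lambda>s. G v s - G w s)) \<le> integral {0..t} (\<lambda>s. K * d * exp (\<mu> * s))"
    proof (rule integral_norm_bound_integral)
      show "(\<lambda>s. G v s - G w s) integrable_on {0..t}"
        by (intro integrable_continuous_real continuous_intros contG)
      show "(\<lambda>s. K * d * exp (\<mu> * s)) integrable_on {0..t}"
        by (intro integrable_continuous_real continuous_intros)
      fix s assume "s \<in> {0..t}"
      have "norm (G v s - G w s) \<le> K * norm (exp (\<mu> * s) *\<^sub>R v s - exp (\<mu> * s) *\<^sub>R w s)"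
        unfolding G_def by (rule lipschitz_on_normD[OF lip]) auto
      also have "\<dots> = K * (exp (\<mu> * s) * dist (v s) (w s))"
        by (simp add: dist_norm flip: scaleR_diff_right)
      also have "\<dots> \<le> K * (exp (\<mu> * s) * d)"
        using K dist_bounded[of v s w] by (intro mult_left_mono) (auto simp: d_def)
      finally show "norm (G v s - G w s) \<le> K * d * exp (\<mu> * s)" by (simp add: mult_ac)
    qed
    also have "\<dots> = K * d / \<mu> * exp (\<mu> * t) - K * d / \<mu> * exp (\<mu> * 0)"
      using \<mu> t by (intro integral_unique fundamental_theorem_of_calculus)
        (auto intro!: derivative_eq_intros simp flip: has_real_derivative_iff_has_vector_derivative)
    also have "\<dots> \<le> K * d / \<mu> * exp (\<mu> * t)" using K \<open>d \<ge> 0\<close> \<mu> by auto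
    \<comment> \<open>K / \<mu> is at most 1/2 by the choice \<open>\<mu> = 2 * K + 1\<close>; the
      summand 1 keeps \<mu> positive when K = 0.\<close>
    also have "\<dots> \<le> 1/2 * d * exp (\<mu> * t)"
      using \<mu> mult_right_mono[OF \<mu>(2) \<open>d \<ge> 0\<close>] by (intro mult_right_mono) (auto simp: field_simps)
    finally have "norm (integral {0..t} (G v) - integral {0..t} (G w)) \<le> 1/2 * d * exp (\<mu> * t)"
      by (subst (asm) integral_diff) (auto intro!: integrable_continuous_real contG)
    then have "exp (- \<mu> * t) * norm (integral {0..t} (G v) - integral {0..t} (G w)) \<le> 1/2 * d"
      by (simp add: exp_minus field_simps)
    then show "dist (apply_bcontfun (\<Phi> v) s) (apply_bcontfun (\<Phi> w) s) \<le> 1/2 * dist v w"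
      unfolding \<Phi> t_def[symmetric] P_def d_def[symmetric] by (simp add: dist_norm flip: scaleR_diff_right)
  qed
  obtain v where v: "\<Phi> v = v"
    using banach_fix_type[of "1/2" \<Phi>] contract by auto
  define u where "u t = x0 + integral {0..t} (G v)" for t
  have vu: "exp (\<mu> * t) *\<^sub>R v t = u t" if "t \<in> {0..T}" for t
  proof -
    have "v t = P v t" using \<Phi>[of v t] that v by (simp add: clamp_cancel_cbox)
    then show ?thesis by (simp add: P_def u_def exp_minus)
  qed
  show thesis
  proof
    show "u 0 = x0" by (simp add: u_def)
    fix t assume t: "t \<in> {0..T}"
    have "(u has_vector_derivative 0 + G v t) (at t within {0..T})"
      unfolding u_def
      by (intro has_vector_derivative_add has_vector_derivative_const integral_has_vector_derivative contG t)
    then show "(u has_vector_derivative F (u t)) (at t within {0..T})"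
      using vu[OF t] by (simp add: G_def)
  qed
qed

section \<open>Lipschitz bounds for sine and cosine\<close>

lemma abs_cos_diff_le: "\<bar>cos x - cos y\<bar> \<le> \<bar>x - y\<bar>" for x y :: real
  using field_differentiable_bound[of UNIV cos "\<lambda>x. - sin x" 1 x y]
  by (auto intro!: derivative_eq_intros)

lemma abs_sin_diff_le: "\<bar>sin x - sin y\<bar> \<le> \<bar>x - y\<bar>" for x y :: real
  using field_differentiable_bound[of UNIV sin cos 1 x y]
  by (auto intro!: derivative_eq_intros)

section \<open>The truncated system\<close>

definition length_clamp :: "real \<Rightarrow> real" where
  "length_clamp x = max (1/2) (min (3/2) x)"

lemma length_clamp_bounds: "1/2 \<le> length_clamp x" "length_clamp x \<le> 3/2"
  by (auto simp: length_clamp_def)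

lemma length_clamp_eq: "\<bar>x - 1\<bar> \<le> 1/2 \<Longrightarrow> length_clamp x = x"
  unfolding length_clamp_def by linarith

text \<open>A state consists of length, radial velocity, angle and angular momentum. Besides the
  length, the momentum is truncated, to [-1, 1], because its square is not globally Lipschitz. The
  linear restoring term keeps the untruncated length.\<close>

definition clamped_field :: "real \<Rightarrow> real \<Rightarrow> real \<times> real \<times> real \<times> real \<Rightarrow> real \<times> real \<times> real \<times> real" where
  "clamped_field \<epsilon> \<omega> = (\<lambda>(x, y, \<theta>, p).
     let g = length_clamp x; q = max (-1) (min 1 p) in
       (y, (1 - x - \<epsilon>\<^sup>2 * cos \<theta>) / \<omega>\<^sup>2 + q\<^sup>2 / g ^ 3, q / g\<^sup>2, \<epsilon>\<^sup>2 / \<omega>\<^sup>2 * g * sin \<theta>))"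

text \<open>Boundedness is included because products of Lipschitz functions need not be Lipschitz;
  the bounded ones are closed under products.\<close>

definition lip_bdd :: "('a::metric_space \<Rightarrow> real) \<Rightarrow> bool" where
  "lip_bdd f \<longleftrightarrow> (\<exists>C. C-lipschitz_on UNIV f) \<and> (\<exists>B. \<forall>x. \<bar>f x\<bar> \<le> B)"

lemma lip_bddI: "C-lipschitz_on UNIV f \<Longrightarrow> (\<And>x. \<bar>f x\<bar> \<le> B) \<Longrightarrow> lip_bdd f"
  unfolding lip_bdd_def by blast

lemma lip_bdd_mult:
  assumes "lip_bdd f" "lip_bdd g"
  shows "lip_bdd (\<lambda>x. f x * g x)"
proof -
  obtain A B C D where *: "C-lipschitz_on UNIV f" "D-lipschitz_on UNIV g"
    "\<And>x. \<bar>f x\<bar> \<le> A" "\<And>x. \<bar>g x\<bar> \<le> B"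
    using assms unfolding lip_bdd_def by metis
  have CD: "0 \<le> C" "0 \<le> D" using * lipschitz_on_nonneg by blast+
  have AB: "0 \<le> A" "0 \<le> B" using *(3,4)[of undefined] by linarith+
  have "(C * B + A * D)-lipschitz_on UNIV (\<lambda>x. f x * g x)"
  proof (rule lipschitz_onI)
    fix x y :: 'a
    have "\<bar>f x * g x - f y * g y\<bar> = \<bar>(f x - f y) * g x + f y * (g x - g y)\<bar>"
      by (simp add: algebra_simps)
    also have "\<dots> \<le> \<bar>f x - f y\<bar> * \<bar>g x\<bar> + \<bar>f y\<bar> * \<bar>g x - g y\<bar>"
      by (metis abs_mult abs_triangle_ineq)
    also have "\<dots> \<le> (C * dist x y) * B + A * (D * dist x y)"
      using lipschitz_onD[OF *(1), of x y] lipschitz_onD[OF *(2), of x y] *(3,4) AB CD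
      by (intro add_mono mult_mono) (auto simp: dist_real_def)
    finally show "dist (f x * g x) (f y * g y) \<le> (C * B + A * D) * dist x y"
      by (simp add: dist_real_def algebra_simps)
  qed (use AB CD in auto)
  moreover have "\<bar>f x * g x\<bar> \<le> A * B" for x
    using *(3,4)[of x] by (simp add: abs_mult AB mult_mono)
  ultimately show ?thesis by (rule lip_bddI)
qed

lemma lip_bdd_power: "lip_bdd f \<Longrightarrow> lip_bdd (\<lambda>x. f x ^ Suc n)"
  by (induction n) (auto intro: lip_bdd_mult)

lemma lip_bdd_cmult: "lip_bdd f \<Longrightarrow> lip_bdd (\<lambda>x. c * f x)"
  by (rule lip_bdd_mult) (auto intro!: lip_bddI[of 0 _ "\<bar>c\<bar>"] lipschitz_on_constant)

lemma lip_bdd_compose: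
  assumes "lip_bdd f" "D-lipschitz_on UNIV h"
  shows "lip_bdd (\<lambda>x. f (h x))"
  using assms unfolding lip_bdd_def
  by (metis lipschitz_on_compose2 lipschitz_on_subset subset_UNIV)

text \<open>Apart from two linear terms, the field is built from products of the truncations, the
  reciprocal of the truncated length, sine and cosine, all bounded and Lipschitz in one coordinate
  each. The reciprocal is harmless because the truncated length is at least 1/2.\<close>

lemma lipschitz_clamped_field: "\<exists>K. K-lipschitz_on UNIV (clamped_field \<epsilon> \<omega>)"
proof -
  have sin: "lip_bdd (sin :: real \<Rightarrow> real)" and cos: "lip_bdd (cos :: real \<Rightarrow> real)"
    by (rule lip_bddI[of 1 _ 1], rule lipschitz_onI; simp add: dist_real_def abs_sin_diff_le abs_cos_diff_le)+
  have g: "lip_bdd (\<lambda>x::real. max (1/2) (min (3/2) x))"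
    by (rule lip_bddI[of 1 _ "3/2"], rule lipschitz_onI) (auto simp: dist_real_def)
  have q: "lip_bdd (\<lambda>x::real. max (-1) (min 1 x))"
    by (rule lip_bddI[of 1 _ 1], rule lipschitz_onI) (auto simp: dist_real_def)
  have ig: "lip_bdd (\<lambda>x::real. inverse (max (1/2) (min (3/2) x)))"
  proof (rule lip_bddI[of 4 _ 2], rule lipschitz_onI)
    fix x y :: real
    define a b where "a = max (1/2) (min (3/2) x)" and "b = max (1/2) (min (3/2) y)"
    have ab: "1/2 \<le> a" "1/2 \<le> b" "\<bar>b - a\<bar> \<le> \<bar>x - y\<bar>" by (auto simp: a_def b_def)
    have "1 \<le> 4 * (a * b)" using mult_mono[of "1/2" a "1/2" b] ab by simp
    moreover have "\<bar>inverse a - inverse b\<bar> = \<bar>b - a\<bar> / (a * b)"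
      using ab by (simp add: field_simps abs_mult abs_divide)
    ultimately show "dist (inverse a) (inverse b) \<le> 4 * dist x y"
      using ab mult_mono[of "\<bar>b - a\<bar>" "\<bar>x - y\<bar>" 1 "4 * (a*b)"]
      by (simp add: dist_real_def field_simps)
  next
    fix x :: real
    show "\<bar>inverse (max (1/2) (min (3/2) x))\<bar> \<le> 2"
      using le_imp_inverse_le[of "1/2" "max (1/2) (min (3/2) x)"] by simp
  qed simp
  define fx fy f\<theta> fp :: "real \<times> real \<times> real \<times> real \<Rightarrow> real" where
    defs: "fx = fst" "fy = (\<lambda>z. fst (snd z))" "f\<theta> = (\<lambda>z. fst (snd (snd z)))" "fp = (\<lambda>z. snd (snd (snd z)))"
  have c: "1-lipschitz_on UNIV fx" "1-lipschitz_on UNIV fy" "1-lipschitz_on UNIV f\<theta>" "1-lipschitz_on UNIV fp"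
    unfolding defs
    by (rule lipschitz_onI,
        simp_all add: dist_fst_le order_trans[OF dist_fst_le dist_snd_le]
          order_trans[OF dist_fst_le order_trans[OF dist_snd_le dist_snd_le]]
          order_trans[OF dist_snd_le order_trans[OF dist_snd_le dist_snd_le]])+
  note g' = lip_bdd_compose[OF g c(1)] and ig' = lip_bdd_compose[OF ig c(1)]
    and q' = lip_bdd_compose[OF q c(4)] and sin' = lip_bdd_compose[OF sin c(3)]
    and cos' = lip_bdd_compose[OF cos c(3)]
  let ?g = "\<lambda>z. max (1/2) (min (3/2) (fx z))" and ?q = "\<lambda>z. max (-1) (min 1 (fp z))"
  obtain C1 C2 C3 C4 where C:
    "C1-lipschitz_on UNIV (\<lambda>z. \<epsilon>\<^sup>2 / \<omega>\<^sup>2 * cos (f\<theta> z))"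
    "C2-lipschitz_on UNIV (\<lambda>z. ?q z ^ Suc 1 * inverse (?g z) ^ Suc 2)"
    "C3-lipschitz_on UNIV (\<lambda>z. ?q z * inverse (?g z) ^ Suc 1)"
    "C4-lipschitz_on UNIV (\<lambda>z. \<epsilon>\<^sup>2 / \<omega>\<^sup>2 * (?g z * sin (f\<theta> z)))"
  proof -
    have "lip_bdd (\<lambda>z. \<epsilon>\<^sup>2 / \<omega>\<^sup>2 * cos (f\<theta> z))"
      "lip_bdd (\<lambda>z. ?q z ^ Suc 1 * inverse (?g z) ^ Suc 2)"
      "lip_bdd (\<lambda>z. ?q z * inverse (?g z) ^ Suc 1)"
      "lip_bdd (\<lambda>z. \<epsilon>\<^sup>2 / \<omega>\<^sup>2 * (?g z * sin (f\<theta> z)))"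
      by (intro lip_bdd_mult lip_bdd_cmult lip_bdd_power g' ig' q' sin' cos')+
    then show thesis using that unfolding lip_bdd_def by blast
  qed
  \<comment> \<open>The restoring term is Lipschitz but unbounded, hence outside the class
    \<open>lip_bdd\<close>; it is only added, never multiplied.\<close>
  have lin: "\<bar>1 / \<omega>\<^sup>2\<bar>-lipschitz_on UNIV (\<lambda>z. 1 / \<omega>\<^sup>2 * (1 - fx z))"
    using lipschitz_on_cmult_real[OF
      lipschitz_on_diff[OF lipschitz_on_constant[of UNIV "1::real"] c(1)], of "1/\<omega>\<^sup>2"] by simp
  have eq: "clamped_field \<epsilon> \<omega> = (\<lambda>z. (fy z,
     1 / \<omega>\<^sup>2 * (1 - fx z) - \<epsilon>\<^sup>2 / \<omega>\<^sup>2 * cos (f\<theta> z)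
       + ?q z ^ Suc 1 * inverse (?g z) ^ Suc 2,
     ?q z * inverse (?g z) ^ Suc 1,
     \<epsilon>\<^sup>2 / \<omega>\<^sup>2 * (?g z * sin (f\<theta> z))))"
  proof (rule ext)
    fix z
    define x c s g q where "x = fx z" and "c = cos (f\<theta> z)" and "s = sin (f\<theta> z)"
      and "g = max (1/2) (min (3/2) (fx z))" and "q = max (-1) (min 1 (fp z))"
    have e: "(1 - x - \<epsilon>\<^sup>2 * c) / \<omega>\<^sup>2 + q\<^sup>2 / g ^ 3 =
        1 / \<omega>\<^sup>2 * (1 - x) - \<epsilon>\<^sup>2 / \<omega>\<^sup>2 * c + q ^ Suc 1 * inverse g ^ Suc 2"
      "q / g\<^sup>2 = q * inverse g ^ Suc 1"
      by (simp_all add: divide_inverse power_inverse numeral_2_eq_2 numeral_3_eq_3) (simp add: algebra_simps)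
    have "clamped_field \<epsilon> \<omega> z =
        (fy z, (1 - x - \<epsilon>\<^sup>2 * c) / \<omega>\<^sup>2 + q\<^sup>2 / g ^ 3, q / g\<^sup>2, \<epsilon>\<^sup>2 / \<omega>\<^sup>2 * (g * s))"
      unfolding x_def c_def s_def g_def q_def defs clamped_field_def length_clamp_def Let_def
      by (simp add: case_prod_beta)
    then show "clamped_field \<epsilon> \<omega> z = (fy z,
        1 / \<omega>\<^sup>2 * (1 - fx z) - \<epsilon>\<^sup>2 / \<omega>\<^sup>2 * cos (f\<theta> z)
          + ?q z ^ Suc 1 * inverse (?g z) ^ Suc 2,
        ?q z * inverse (?g z) ^ Suc 1,
        \<epsilon>\<^sup>2 / \<omega>\<^sup>2 * (?g z * sin (f\<theta> z)))"
      unfolding e unfolding x_def c_def s_def g_def q_def .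
  qed
  show ?thesis unfolding eq
    by (rule exI) (rule lipschitz_on_Pair c C lin lipschitz_on_add lipschitz_on_diff)+
qed

section \<open>Energy estimate for the oscillator\<close>

lemma has_real_derivative_bound_within:
  fixes f :: "real \<Rightarrow> real"
  assumes "\<And>\<tau>. \<tau> \<in> {0..S} \<Longrightarrow> (f has_real_derivative f' \<tau>) (at \<tau> within {0..S})"
    and "\<And>\<tau>. \<tau> \<in> {0..S} \<Longrightarrow> \<bar>f' \<tau>\<bar> \<le> B" and "t \<in> {0..S}"
  shows "\<bar>f t - f 0\<bar> \<le> B * t"
  using field_differentiable_bound[of "{0..S}" f f' B t 0] assms by auto

lemma has_real_derivative_nonpos_within:
  fixes f :: "real \<Rightarrow> real"
  assumes "\<And>\<tau>. \<tau> \<in> {0..S} \<Longrightarrow> (f has_real_derivative f' \<tau>) (at \<tau> within {0..S})"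
    and "\<And>\<tau>. \<tau> \<in> {0..S} \<Longrightarrow> f' \<tau> \<le> 0" and t: "t \<in> {0..S}"
  shows "f t \<le> f 0"
proof (cases "t = 0")
  case False
  then have "0 < t" using t by auto
  have "(f has_derivative (*) (f' x)) (at x within {0..t})" if "0 \<le> x" "x \<le> t" for x
    using DERIV_subset[OF assms(1), of x "{0..t}"] that t by (simp add: has_field_derivative_def)
  then obtain z where "z \<in> {0<..<t}" "f t - f 0 = f' z * (t - 0)"
    using mvt_simple[OF \<open>0 < t\<close>, of f "\<lambda>x. (*) (f' x)"] by blast
  moreover from this have "f' z * (t - 0) \<le> 0"
    using assms(2)[of z] t by (intro mult_nonpos_nonneg) auto
  ultimately show ?thesis by simp
qed simp

text \<open>Adding R^2 to the energy \<omega>^2 M'^2 + M^2 absorbs the forcing: E' = 2 M'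
  (\<omega>^2 M'' + M) is at most M'^2 + R^2, and \<omega>^2 \<ge> 1/2 bounds this by 2 E. Hence E
  exp (-2 t) does not increase, and E(0) is at most (|M'(0)| + R)^2 because M(0) = 0 and \<omega>^2
  \<le> 1.\<close>

lemma oscillator_bound:
  fixes M :: "real \<Rightarrow> real"
  assumes M: "\<And>\<tau>. \<tau> \<in> {0..S} \<Longrightarrow> (M has_real_derivative M1 \<tau>) (at \<tau> within {0..S})"
    and M1: "\<And>\<tau>. \<tau> \<in> {0..S} \<Longrightarrow> (M1 has_real_derivative M2 \<tau>) (at \<tau> within {0..S})"
    and \<omega>: "1/2 \<le> \<omega>\<^sup>2" "\<omega>\<^sup>2 \<le> 1"
    and R: "\<And>\<tau>. \<tau> \<in> {0..S} \<Longrightarrow> \<bar>\<omega>\<^sup>2 * M2 \<tau> + M \<tau>\<bar> \<le> R"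
    and "M 0 = 0" and t: "t \<in> {0..S}"
  shows "\<bar>M t\<bar> \<le> (\<bar>M1 0\<bar> + R) * exp t"
proof -
  have "R \<ge> 0" using R[OF t] by linarith
  define E where "E \<tau> = \<omega>\<^sup>2 * (M1 \<tau>)\<^sup>2 + (M \<tau>)\<^sup>2 + R\<^sup>2" for \<tau>
  define E' where "E' \<tau> = \<omega>\<^sup>2 * (2 * M1 \<tau> * M2 \<tau>) + 2 * M \<tau> * M1 \<tau>" for \<tau>
  have "E t * exp (- (2 * t)) \<le> E 0 * exp (- (2 * 0))"
  proof (rule has_real_derivative_nonpos_within[OF _ _ t])
    fix \<tau> assume \<tau>: "\<tau> \<in> {0..S}"
    show "((\<lambda>\<tau>. E \<tau> * exp (- (2 * \<tau>))) has_real_derivative (E' \<tau> - 2 * E \<tau>) * exp (- (2 * \<tau>)))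
      (at \<tau> within {0..S})"
      unfolding E_def
      by (rule derivative_eq_intros M[OF \<tau>] M1[OF \<tau>] refl)+ (simp add: E'_def E_def algebra_simps)
    have "E' \<tau> = 2 * M1 \<tau> * (\<omega>\<^sup>2 * M2 \<tau> + M \<tau>)" by (simp add: E'_def algebra_simps)
    also have "\<dots> \<le> (M1 \<tau>)\<^sup>2 + (\<omega>\<^sup>2 * M2 \<tau> + M \<tau>)\<^sup>2" by (rule sum_squares_bound)
    also have "(\<omega>\<^sup>2 * M2 \<tau> + M \<tau>)\<^sup>2 \<le> R\<^sup>2" using R[OF \<tau>] by (simp add: abs_le_square_iff[symmetric] \<open>R \<ge> 0\<close>)
    also have "(M1 \<tau>)\<^sup>2 \<le> 2 * (\<omega>\<^sup>2 * (M1 \<tau>)\<^sup>2)"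
      using mult_right_mono[OF \<omega>(1), of "(M1 \<tau>)\<^sup>2"] by simp
    finally have "E' \<tau> \<le> 2 * E \<tau>" by (simp add: E_def) (smt (verit) zero_le_power2)
    then show "(E' \<tau> - 2 * E \<tau>) * exp (- (2 * \<tau>)) \<le> 0" by (simp add: mult_le_0_iff)
  qed
  then have decay: "E t * exp (- (2 * t)) \<le> E 0" by simp
  have "exp (- (2 * t)) * (exp t)\<^sup>2 = exp (- (2 * t) + (t + t))"
    unfolding power2_eq_square exp_add ..
  then have "E t = (E t * exp (- (2 * t))) * (exp t)\<^sup>2" by simp
  also have "\<dots> \<le> E 0 * (exp t)\<^sup>2" using decay by (rule mult_right_mono) simp
  also have "\<dots> \<le> (\<bar>M1 0\<bar> + R)\<^sup>2 * (exp t)\<^sup>2"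
  proof (rule mult_right_mono)
    have "\<omega>\<^sup>2 * (M1 0)\<^sup>2 \<le> 1 * (M1 0)\<^sup>2" using \<omega> by (intro mult_right_mono) auto
    moreover have "0 \<le> 2 * \<bar>M1 0\<bar> * R" using \<open>R \<ge> 0\<close> by simp
    moreover have "(\<bar>M1 0\<bar> + R)\<^sup>2 = (M1 0)\<^sup>2 + R\<^sup>2 + 2 * \<bar>M1 0\<bar> * R" by (simp add: power2_sum)
    ultimately show "E 0 \<le> (\<bar>M1 0\<bar> + R)\<^sup>2"
      unfolding E_def \<open>M 0 = 0\<close> zero_power2 by linarith
  qed simp
  finally have "(M t)\<^sup>2 \<le> ((\<bar>M1 0\<bar> + R) * exp t)\<^sup>2"
    using \<omega> unfolding E_def power_mult_distrib by (smt (verit) mult_nonneg_nonneg zero_le_power2)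
  then show ?thesis using \<open>R \<ge> 0\<close> by (simp flip: abs_le_square_iff)
qed

section \<open>Uniform orders of magnitude\<close>

text \<open>
  \<open>s \<in> D\<close> is a trajectory with parameter \<open>e s\<close>, defined on \<open>{0..len s}\<close>. A Landau symbol along the
  filter below on pairs (trajectory, time) is a bound as \<open>e s\<close> tends to \<open>0\<close> from the right that is
  uniform in the trajectory and in the time.
\<close>

locale parameter_family =
  fixes D :: "'s set" and e len :: "'s \<Rightarrow> real" and T :: real
  assumes len: "s \<in> D \<Longrightarrow> 0 \<le> len s" "s \<in> D \<Longrightarrow> len s \<le> T"
begin

definition along :: "('s \<times> real) filter" where
  "along = inf (filtercomap (\<lambda>x. e (fst x)) (at_right 0)) (principal {(s, \<tau>). s \<in> D \<and> \<tau> \<in> {0..len s}})"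

lemma eventually_along:
  "eventually P along \<longleftrightarrow> (\<forall>\<^sub>F \<epsilon> in at_right 0. \<forall>s\<in>D. e s = \<epsilon> \<longrightarrow> (\<forall>\<tau>\<in>{0..len s}. P (s, \<tau>)))"
  unfolding along_def eventually_inf_principal eventually_filtercomap
  by (auto elim!: eventually_mono)

abbreviation ord :: "nat \<Rightarrow> ('s \<times> real \<Rightarrow> real) set" where
  "ord n \<equiv> O[along](\<lambda>x. e (fst x) ^ n)"

lemma eventually_along_param:
  "eventually P (at_right 0) \<Longrightarrow> eventually (\<lambda>x. P (e (fst x))) along"
  unfolding eventually_along by (auto elim: eventually_mono)

lemma eventually_in_domain: "eventually (\<lambda>x. fst x \<in> D \<and> 0 \<le> snd x \<and> snd x \<le> len (fst x)) along"
  unfolding eventually_along by auto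

lemma eventually_param_pos: "eventually (\<lambda>x. 0 < e (fst x)) along"
  by (rule eventually_along_param) (simp add: eventually_at_right_less)

text \<open>Through this form, estimates for a single trajectory enter and leave the Landau
  calculus: the constant and the threshold on the parameter are fixed before the trajectory and the
  time. The norm around the power disappears because the parameter is positive.\<close>

lemma in_ord_iff:
  "f \<in> ord n \<longleftrightarrow> (\<exists>C\<ge>0. \<forall>\<^sub>F \<epsilon> in at_right 0. \<forall>s\<in>D. e s = \<epsilon> \<longrightarrow> (\<forall>\<tau>\<in>{0..len s}. \<bar>f (s, \<tau>)\<bar> \<le> C * \<epsilon> ^ n))"
proof
  assume "f \<in> ord n"
  then obtain C where C: "C > 0" "eventually (\<lambda>x. norm (f x) \<le> C * norm (e (fst x) ^ n)) along"
    by (rule landau_o.bigE)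
  from C(2) eventually_param_pos have "eventually (\<lambda>x. \<bar>f x\<bar> \<le> C * e (fst x) ^ n) along"
    by eventually_elim simp
  then show "\<exists>C\<ge>0. \<forall>\<^sub>F \<epsilon> in at_right 0. \<forall>s\<in>D. e s = \<epsilon> \<longrightarrow> (\<forall>\<tau>\<in>{0..len s}. \<bar>f (s, \<tau>)\<bar> \<le> C * \<epsilon> ^ n)"
    using C(1) unfolding eventually_along by (intro exI[of _ C]) (auto elim: eventually_mono)
next
  assume "\<exists>C\<ge>0. \<forall>\<^sub>F \<epsilon> in at_right 0. \<forall>s\<in>D. e s = \<epsilon> \<longrightarrow> (\<forall>\<tau>\<in>{0..len s}. \<bar>f (s, \<tau>)\<bar> \<le> C * \<epsilon> ^ n)"
  then obtain C where C: "C \<ge> 0" "eventually (\<lambda>x. \<bar>f x\<bar> \<le> C * e (fst x) ^ n) along"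
    unfolding eventually_along by (auto elim: eventually_mono)
  from C(2) eventually_param_pos have "eventually (\<lambda>x. norm (f x) \<le> C * norm (e (fst x) ^ n)) along"
    by eventually_elim simp
  then show "f \<in> ord n" by (rule bigoI)
qed

lemma ord_mono:
  assumes "f \<in> ord m" "n \<le> m"
  shows "f \<in> ord n"
proof -
  have "eventually (\<lambda>\<epsilon>::real. \<epsilon> < 1) (at_right 0)" by (intro eventually_at_rightI[of 0 1]) auto
  from eventually_along_param[OF this] eventually_param_pos
  have "eventually (\<lambda>x. norm (e (fst x) ^ m) \<le> 1 * norm (e (fst x) ^ n)) along"
    by eventually_elim (use \<open>n \<le> m\<close> in \<open>simp add: power_decreasing\<close>)
  then have "(\<lambda>x. e (fst x) ^ m) \<in> ord n" by (rule bigoI)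
  with assms(1) show ?thesis by (rule landau_o.big_trans)
qed

text \<open>The exponent k is free below m + n, so that surplus orders are dropped in the same
  step.\<close>

lemma ord_mult: "f \<in> ord m \<Longrightarrow> g \<in> ord n \<Longrightarrow> k \<le> m + n \<Longrightarrow> (\<lambda>x. f x * g x) \<in> ord k"
  by (rule ord_mono[of _ "m + n"]) (auto simp: power_add intro: landau_o.big_mult)

lemma ord_cong: "eventually (\<lambda>x. f x = g x) along \<Longrightarrow> g \<in> ord n \<Longrightarrow> f \<in> ord n"
  using landau_o.big.in_cong by blast

lemma ord_bounded: "eventually (\<lambda>x. \<bar>f x\<bar> \<le> B) along \<Longrightarrow> f \<in> ord 0"
  by (rule bigoI[of _ B]) simp

lemma ord_const: "(\<lambda>_. c) \<in> ord 0"
  by (rule ord_bounded[of _ "\<bar>c\<bar>"]) simp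

lemma ord_dominated: "eventually (\<lambda>x. \<bar>f x\<bar> \<le> \<bar>g x\<bar>) along \<Longrightarrow> g \<in> ord n \<Longrightarrow> f \<in> ord n"
  by (rule landau_o.big_trans[of _ _ g]) (auto intro: bigoI[of _ 1])

lemma ord_small:
  assumes "f \<in> ord n" "0 < n" "0 < d"
  shows "eventually (\<lambda>x. \<bar>f x\<bar> < d) along"
proof -
  obtain C where C: "C > 0" "eventually (\<lambda>x. norm (f x) \<le> C * norm (e (fst x) ^ 1)) along"
    using ord_mono[OF assms(1), of 1] assms(2) by (auto elim: landau_o.bigE)
  have "eventually (\<lambda>\<epsilon>::real. \<epsilon> < d / C) (at_right 0)"
    using assms(3) C(1) by (intro eventually_at_rightI[of 0 "d/C"]) auto
  from eventually_along_param[OF this] eventually_param_pos C(2) show ?thesis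
    by eventually_elim (use C(1) in \<open>simp add: field_simps\<close>)
qed

text \<open>All trajectories live on intervals of length at most T, so integration in time costs the
  factor T but no power of \<epsilon>.\<close>

lemma ord_integrate:
  assumes "\<And>s \<tau>. s \<in> D \<Longrightarrow> \<tau> \<in> {0..len s} \<Longrightarrow> (f s has_real_derivative f' (s, \<tau>)) (at \<tau> within {0..len s})"
    and f': "f' \<in> ord n" and f0: "(\<lambda>x. f (fst x) 0) \<in> ord n"
  shows "(\<lambda>x. f (fst x) (snd x)) \<in> ord n"
proof -
  obtain C where "C \<ge> 0" and C: "\<forall>\<^sub>F \<epsilon> in at_right 0. \<forall>s\<in>D. e s = \<epsilon> \<longrightarrow> (\<forall>\<tau>\<in>{0..len s}. \<bar>f' (s, \<tau>)\<bar> \<le> C * \<epsilon> ^ n)"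
    using f' unfolding in_ord_iff by blast
  from C eventually_at_right_less have "\<forall>\<^sub>F \<epsilon> in at_right 0. \<forall>s\<in>D. e s = \<epsilon> \<longrightarrow>
     (\<forall>\<tau>\<in>{0..len s}. \<bar>f s \<tau> - f s 0\<bar> \<le> (C * T) * \<epsilon> ^ n)"
  proof (eventually_elim, intro ballI impI)
    fix \<epsilon> s \<tau>
    assume *: "\<forall>s\<in>D. e s = \<epsilon> \<longrightarrow> (\<forall>\<tau>\<in>{0..len s}. \<bar>f' (s, \<tau>)\<bar> \<le> C * \<epsilon> ^ n)" "0 < \<epsilon>"
      "s \<in> D" "e s = \<epsilon>" "\<tau> \<in> {0..len s}"
    have "\<bar>f s \<tau> - f s 0\<bar> \<le> (C * \<epsilon> ^ n) * \<tau>"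
      using * by (intro has_real_derivative_bound_within[of "len s" _ "\<lambda>\<tau>. f' (s, \<tau>)"] assms(1)) auto
    also have "\<dots> \<le> (C * \<epsilon> ^ n) * T"
      using * len[of s] \<open>C \<ge> 0\<close> by (intro mult_left_mono) auto
    finally show "\<bar>f s \<tau> - f s 0\<bar> \<le> (C * T) * \<epsilon> ^ n" by (simp add: mult_ac)
  qed
  from this eventually_at_right_less have
    "eventually (\<lambda>x. norm (f (fst x) (snd x) - f (fst x) 0) \<le> (C * T) * norm (e (fst x) ^ n)) along"
    unfolding eventually_along by eventually_elim auto
  then have "(\<lambda>x. f (fst x) (snd x) - f (fst x) 0) \<in> ord n" by (rule bigoI)
  from sum_in_bigo(1)[OF this f0] show ?thesis by simp
qed

text \<open>Uniform version of \<open>oscillator_bound\<close>: the growth factor is at most exp T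
  for every trajectory, so the order of the error is that of the residual and of the initial
  velocity.\<close>

lemma ord_oscillator:
  assumes M: "\<And>s \<tau>. s \<in> D \<Longrightarrow> \<tau> \<in> {0..len s} \<Longrightarrow> (M s has_real_derivative M1 s \<tau>) (at \<tau> within {0..len s})"
    and M1: "\<And>s \<tau>. s \<in> D \<Longrightarrow> \<tau> \<in> {0..len s} \<Longrightarrow> (M1 s has_real_derivative M2 s \<tau>) (at \<tau> within {0..len s})"
    and \<omega>: "\<forall>\<^sub>F \<epsilon> in at_right 0. 1/2 \<le> (\<omega> \<epsilon>)\<^sup>2 \<and> (\<omega> \<epsilon>)\<^sup>2 \<le> 1"
    and R: "(\<lambda>x. (\<omega> (e (fst x)))\<^sup>2 * M2 (fst x) (snd x) + M (fst x) (snd x)) \<in> ord n"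
    and M0: "\<And>s. s \<in> D \<Longrightarrow> M s 0 = 0" and M10: "(\<lambda>x. M1 (fst x) 0) \<in> ord n"
  shows "(\<lambda>x. M (fst x) (snd x)) \<in> ord n"
proof -
  obtain B where "B \<ge> 0" and B: "\<forall>\<^sub>F \<epsilon> in at_right 0. \<forall>s\<in>D. e s = \<epsilon> \<longrightarrow> (\<forall>\<tau>\<in>{0..len s}. \<bar>M1 s 0\<bar> \<le> B * \<epsilon> ^ n)"
    using M10 unfolding in_ord_iff fst_conv by blast
  obtain C where "C \<ge> 0" and C: "\<forall>\<^sub>F \<epsilon> in at_right 0. \<forall>s\<in>D. e s = \<epsilon> \<longrightarrow> (\<forall>\<tau>\<in>{0..len s}. \<bar>(\<omega> (e s))\<^sup>2 * M2 s \<tau> + M s \<tau>\<bar> \<le> C * \<epsilon> ^ n)"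
    using R unfolding in_ord_iff fst_conv snd_conv by blast
  from B C \<omega> eventually_at_right_less have "\<forall>\<^sub>F \<epsilon> in at_right 0. \<forall>s\<in>D. e s = \<epsilon> \<longrightarrow>
     (\<forall>\<tau>\<in>{0..len s}. \<bar>M s \<tau>\<bar> \<le> ((B + C) * exp T) * \<epsilon> ^ n)"
  proof (eventually_elim, intro ballI impI)
    fix \<epsilon> s t
    assume *: "\<forall>s\<in>D. e s = \<epsilon> \<longrightarrow> (\<forall>\<tau>\<in>{0..len s}. \<bar>M1 s 0\<bar> \<le> B * \<epsilon> ^ n)"
      "\<forall>s\<in>D. e s = \<epsilon> \<longrightarrow> (\<forall>\<tau>\<in>{0..len s}. \<bar>(\<omega> (e s))\<^sup>2 * M2 s \<tau> + M s \<tau>\<bar> \<le> C * \<epsilon> ^ n)"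
      "1/2 \<le> (\<omega> \<epsilon>)\<^sup>2 \<and> (\<omega> \<epsilon>)\<^sup>2 \<le> 1" "0 < \<epsilon>" "s \<in> D" "e s = \<epsilon>" "t \<in> {0..len s}"
    have "\<bar>M s t\<bar> \<le> (\<bar>M1 s 0\<bar> + C * \<epsilon> ^ n) * exp t"
      using * by (intro oscillator_bound[of "len s" _ _ "M2 s" "\<omega> \<epsilon>"] M M1 M0) auto
    also have "\<dots> \<le> (B * \<epsilon> ^ n + C * \<epsilon> ^ n) * exp T"
      using * len[of s] \<open>C \<ge> 0\<close> \<open>B \<ge> 0\<close> by (intro mult_mono add_mono) auto
    finally show "\<bar>M s t\<bar> \<le> ((B + C) * exp T) * \<epsilon> ^ n" by (simp add: algebra_simps)
  qed
  then show ?thesis unfolding in_ord_iff fst_conv snd_conv using \<open>C \<ge> 0\<close> \<open>B \<ge> 0\<close>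
    by (intro exI[of _ "(B + C) * exp T"]) auto
qed

end

section \<open>Solutions of the truncated system\<close>

text \<open>Only the length is truncated here, while the momentum appears as it is. The interval
  [0, S] is a parameter, so that the notion also applies to an original solution up to a time before
  which its length is known to stay near 1.\<close>

definition clamped_solution ::
    "real \<Rightarrow> real \<Rightarrow> real \<Rightarrow> real \<Rightarrow> real \<Rightarrow> (real \<Rightarrow> real) \<Rightarrow> (real \<Rightarrow> real) \<Rightarrow>
      (real \<Rightarrow> real) \<Rightarrow> (real \<Rightarrow> real) \<Rightarrow> bool" where
  "clamped_solution \<alpha> \<theta>\<^sub>d L\<^sub>d \<epsilon> S L y \<theta> p \<longleftrightarrow>
    (let \<omega> = strained_freq \<theta>\<^sub>d \<epsilon>; g = (\<lambda>\<tau>. length_clamp (L \<tau>)) in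
       (\<forall>\<tau>\<in>{0..S}.
          (L has_real_derivative y \<tau>) (at \<tau> within {0..S}) \<and>
          (y has_real_derivative (1 - L \<tau> - \<epsilon>\<^sup>2 * cos (\<theta> \<tau>)) / \<omega>\<^sup>2 + (p \<tau>)\<^sup>2 / g \<tau> ^ 3) (at \<tau> within {0..S}) \<and>
          (\<theta> has_real_derivative p \<tau> / (g \<tau>)\<^sup>2) (at \<tau> within {0..S}) \<and>
          (p has_real_derivative \<epsilon>\<^sup>2 / \<omega>\<^sup>2 * g \<tau> * sin (\<theta> \<tau>)) (at \<tau> within {0..S})) \<and>
       L 0 = 1 \<and> y 0 = - (\<epsilon> / \<omega> * L\<^sub>d) \<and> \<theta> 0 = - \<alpha> \<and> p 0 = \<epsilon> / \<omega> * \<theta>\<^sub>d)"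

text \<open>Since the truncated length is at most 3/2, the momentum changes by at most (3/2)
  (\<epsilon>^2 / \<omega>^2) T. The smallness hypothesis therefore keeps it in [-1, 1], where the
  momentum truncation of \<open>clamped_field\<close> is inactive.\<close>

lemma clamped_solution_exists:
  assumes T: "0 \<le> T" and small: "\<bar>\<epsilon> / \<omega> * \<theta>\<^sub>d\<bar> + 3/2 * (\<epsilon>\<^sup>2 / \<omega>\<^sup>2) * T \<le> 1"
    and \<omega>: "\<omega> = strained_freq \<theta>\<^sub>d \<epsilon>"
  shows "\<exists>L y \<theta> p. clamped_solution \<alpha> \<theta>\<^sub>d L\<^sub>d \<epsilon> T L y \<theta> p"
proof -
  obtain K where "K-lipschitz_on UNIV (clamped_field \<epsilon> \<omega>)" using lipschitz_clamped_field by blast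
  then obtain u where u0: "u 0 = (1, - (\<epsilon> / \<omega> * L\<^sub>d), - \<alpha>, \<epsilon> / \<omega> * \<theta>\<^sub>d)"
    and u: "\<And>t. t \<in> {0..T} \<Longrightarrow> (u has_vector_derivative clamped_field \<epsilon> \<omega> (u t)) (at t within {0..T})"
    using picard_lindelof_global T by blast
  define L y \<theta> p where defs: "L t = fst (u t)" "y t = fst (snd (u t))"
    "\<theta> t = fst (snd (snd (u t)))" "p t = snd (snd (snd (u t)))" for t
  define g q where "g t = length_clamp (L t)" and "q t = max (-1) (min 1 (p t))" for t
  note lin = bounded_linear_compose[OF bounded_linear_fst bounded_linear_snd]
    bounded_linear_compose[OF bounded_linear_snd bounded_linear_snd]
  have F: "clamped_field \<epsilon> \<omega> (u t) = (y t, (1 - L t - \<epsilon>\<^sup>2 * cos (\<theta> t)) / \<omega>\<^sup>2 + (q t)\<^sup>2 / g t ^ 3,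
      q t / (g t)\<^sup>2, \<epsilon>\<^sup>2 / \<omega>\<^sup>2 * g t * sin (\<theta> t))" for t
    unfolding clamped_field_def defs g_def q_def Let_def by (simp add: case_prod_beta)
  have deriv: "(L has_real_derivative y t) (at t within {0..T})"
    "(y has_real_derivative (1 - L t - \<epsilon>\<^sup>2 * cos (\<theta> t)) / \<omega>\<^sup>2 + (q t)\<^sup>2 / g t ^ 3) (at t within {0..T})"
    "(\<theta> has_real_derivative q t / (g t)\<^sup>2) (at t within {0..T})"
    "(p has_real_derivative \<epsilon>\<^sup>2 / \<omega>\<^sup>2 * g t * sin (\<theta> t)) (at t within {0..T})"
    if t: "t \<in> {0..T}" for t
  proof -
    note s = bounded_linear.has_vector_derivative[OF bounded_linear_snd u[OF t]]
    note ss = bounded_linear.has_vector_derivative[OF bounded_linear_snd s]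
    show "(L has_real_derivative y t) (at t within {0..T})"
      using bounded_linear.has_vector_derivative[OF bounded_linear_fst u[OF t]]
      unfolding F has_real_derivative_iff_has_vector_derivative defs by simp
    show "(y has_real_derivative (1 - L t - \<epsilon>\<^sup>2 * cos (\<theta> t)) / \<omega>\<^sup>2 + (q t)\<^sup>2 / g t ^ 3) (at t within {0..T})"
      using bounded_linear.has_vector_derivative[OF bounded_linear_fst s]
      unfolding F has_real_derivative_iff_has_vector_derivative by (simp add: defs(2)[abs_def])
    show "(\<theta> has_real_derivative q t / (g t)\<^sup>2) (at t within {0..T})"
      using bounded_linear.has_vector_derivative[OF bounded_linear_fst ss]
      unfolding F has_real_derivative_iff_has_vector_derivative by (simp add: defs(3)[abs_def])
    show "(p has_real_derivative \<epsilon>\<^sup>2 / \<omega>\<^sup>2 * g t * sin (\<theta> t)) (at t within {0..T})"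
      using bounded_linear.has_vector_derivative[OF bounded_linear_snd ss]
      unfolding F has_real_derivative_iff_has_vector_derivative by (simp add: defs(4)[abs_def])
  qed
  have q: "q t = p t" if t: "t \<in> {0..T}" for t
  proof -
    have "\<bar>p t - p 0\<bar> \<le> (3/2 * (\<epsilon>\<^sup>2 / \<omega>\<^sup>2)) * t"
    proof (rule has_real_derivative_bound_within[OF deriv(4) _ t])
      fix \<tau>
      have "\<bar>\<epsilon>\<^sup>2 / \<omega>\<^sup>2\<bar> * (\<bar>g \<tau>\<bar> * \<bar>sin (\<theta> \<tau>)\<bar>) \<le> \<epsilon>\<^sup>2 / \<omega>\<^sup>2 * (3/2 * 1)"
        using length_clamp_bounds[of "L \<tau>"] by (intro mult_mono) (auto simp: g_def)
      then show "\<bar>\<epsilon>\<^sup>2 / \<omega>\<^sup>2 * g \<tau> * sin (\<theta> \<tau>)\<bar> \<le> 3/2 * (\<epsilon>\<^sup>2 / \<omega>\<^sup>2)" by (simp add: abs_mult mult_ac)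
    qed
    also have "\<dots> \<le> (3/2 * (\<epsilon>\<^sup>2 / \<omega>\<^sup>2)) * T" using t by (intro mult_left_mono) auto
    finally have "\<bar>p t - p 0\<bar> \<le> 3/2 * (\<epsilon>\<^sup>2 / \<omega>\<^sup>2) * T" .
    moreover have "p 0 = \<epsilon> / \<omega> * \<theta>\<^sub>d" using u0 by (simp add: defs)
    ultimately have "\<bar>p t\<bar> \<le> 1" using small by linarith
    then show ?thesis by (auto simp: q_def abs_le_iff)
  qed
  have "clamped_solution \<alpha> \<theta>\<^sub>d L\<^sub>d \<epsilon> T L y \<theta> p"
    unfolding clamped_solution_def Let_def \<omega>[symmetric] g_def[symmetric]
    using deriv q u0 by (auto simp: defs)
  then show ?thesis by blast
qed

text \<open>Multiplying the angular equation by L turns its left side into the derivative of the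
  momentum L^2 \<theta>'. The length bound makes the truncation inactive and excludes the degenerate
  case L = 0.\<close>

lemma spring_mass_imp_clamped:
  assumes sol: "spring_mass_solution \<alpha> \<theta>\<^sub>d L\<^sub>d \<epsilon> T L \<theta>" and \<omega>: "strained_freq \<theta>\<^sub>d \<epsilon> \<noteq> 0"
    and S: "0 \<le> S" "S \<le> T" and near: "\<And>\<tau>. \<tau> \<in> {0..S} \<Longrightarrow> \<bar>L \<tau> - 1\<bar> \<le> 1/2"
  shows "\<exists>y p. clamped_solution \<alpha> \<theta>\<^sub>d L\<^sub>d \<epsilon> S L y \<theta> p"
proof -
  define \<omega>' where "\<omega>' = strained_freq \<theta>\<^sub>d \<epsilon>"
  obtain L1 L2 \<theta>1 \<theta>2 where d: "\<And>\<tau>. \<tau> \<in> {0..T} \<Longrightarrow> (L has_real_derivative L1 \<tau>) (at \<tau> within {0..T})"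
    "\<And>\<tau>. \<tau> \<in> {0..T} \<Longrightarrow> (L1 has_real_derivative L2 \<tau>) (at \<tau> within {0..T})"
    "\<And>\<tau>. \<tau> \<in> {0..T} \<Longrightarrow> (\<theta> has_real_derivative \<theta>1 \<tau>) (at \<tau> within {0..T})"
    "\<And>\<tau>. \<tau> \<in> {0..T} \<Longrightarrow> (\<theta>1 has_real_derivative \<theta>2 \<tau>) (at \<tau> within {0..T})"
    and eqL: "\<And>\<tau>. \<tau> \<in> {0..T} \<Longrightarrow> \<omega>'\<^sup>2 * L2 \<tau> + (1 - \<omega>'\<^sup>2 * (\<theta>1 \<tau>)\<^sup>2) * L \<tau> = 1 - \<epsilon>\<^sup>2 * cos (\<theta> \<tau>)"
    and eq\<theta>: "\<And>\<tau>. \<tau> \<in> {0..T} \<Longrightarrow> L \<tau> * \<theta>2 \<tau> + 2 * L1 \<tau> * \<theta>1 \<tau> = \<epsilon>\<^sup>2 / \<omega>'\<^sup>2 * sin (\<theta> \<tau>)"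
    and init: "\<theta> 0 = - \<alpha>" "\<theta>1 0 = \<epsilon> / \<omega>' * \<theta>\<^sub>d" "L 0 = 1" "L1 0 = - (\<epsilon> / \<omega>' * L\<^sub>d)"
    using sol unfolding spring_mass_solution_def Let_def \<omega>'_def by blast
  define p where "p \<tau> = (L \<tau>)\<^sup>2 * \<theta>1 \<tau>" for \<tau>
  have "clamped_solution \<alpha> \<theta>\<^sub>d L\<^sub>d \<epsilon> S L L1 \<theta> p"
    unfolding clamped_solution_def Let_def \<omega>'_def[symmetric]
  proof (intro conjI ballI)
    fix \<tau> assume \<tau>: "\<tau> \<in> {0..S}"
    then have \<tau>T: "\<tau> \<in> {0..T}" and sub: "{0..S} \<subseteq> {0..T}" using S by auto
    note d = d[OF \<tau>T, THEN DERIV_subset, OF sub]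
    have g: "length_clamp (L \<tau>) = L \<tau>" and "L \<tau> \<noteq> 0"
      using near[OF \<tau>] length_clamp_eq by auto
    show "(L has_real_derivative L1 \<tau>) (at \<tau> within {0..S})" by (rule d)
    have "(p \<tau>)\<^sup>2 / L \<tau> ^ 3 = L \<tau> * (\<theta>1 \<tau>)\<^sup>2"
      using \<open>L \<tau> \<noteq> 0\<close> by (simp add: p_def power_mult_distrib power2_eq_square power3_eq_cube)
    moreover have "L2 \<tau> = (1 - \<epsilon>\<^sup>2 * cos (\<theta> \<tau>) - L \<tau>) / \<omega>'\<^sup>2 + L \<tau> * (\<theta>1 \<tau>)\<^sup>2"
      using eqL[OF \<tau>T] \<omega> unfolding \<omega>'_def[symmetric]
      by (simp add: eq_divide_eq algebra_simps add_divide_eq_iff)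
    ultimately have "L2 \<tau> = (1 - L \<tau> - \<epsilon>\<^sup>2 * cos (\<theta> \<tau>)) / \<omega>'\<^sup>2 + (p \<tau>)\<^sup>2 / length_clamp (L \<tau>) ^ 3"
      unfolding g by (simp add: diff_right_commute)
    then show "(L1 has_real_derivative (1 - L \<tau> - \<epsilon>\<^sup>2 * cos (\<theta> \<tau>)) / \<omega>'\<^sup>2 + (p \<tau>)\<^sup>2 / length_clamp (L \<tau>) ^ 3)
        (at \<tau> within {0..S})"
      using d(2) by simp
    show "(\<theta> has_real_derivative p \<tau> / (length_clamp (L \<tau>))\<^sup>2) (at \<tau> within {0..S})"
      using d(3) \<open>L \<tau> \<noteq> 0\<close> by (simp add: g p_def)
    have "(p has_real_derivative L \<tau> * (L \<tau> * \<theta>2 \<tau> + 2 * L1 \<tau> * \<theta>1 \<tau>)) (at \<tau> within {0..S})"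
      unfolding p_def by (rule derivative_eq_intros d refl)+ (simp add: algebra_simps power2_eq_square)
    then show "(p has_real_derivative \<epsilon>\<^sup>2 / \<omega>'\<^sup>2 * length_clamp (L \<tau>) * sin (\<theta> \<tau>)) (at \<tau> within {0..S})"
      unfolding eq\<theta>[OF \<tau>T] g by (simp add: mult_ac)
  qed (simp_all add: init p_def)
  then show ?thesis by blast
qed

text \<open>With L \<ge> 1/2 the angular velocity p / L^2 can be differentiated as a quotient, which
  supplies the second derivative of the angle.\<close>

lemma clamped_imp_spring_mass:
  assumes sol: "clamped_solution \<alpha> \<theta>\<^sub>d L\<^sub>d \<epsilon> T L y \<theta> p" and \<omega>: "strained_freq \<theta>\<^sub>d \<epsilon> \<noteq> 0"
    and near: "\<And>\<tau>. \<tau> \<in> {0..T} \<Longrightarrow> \<bar>L \<tau> - 1\<bar> \<le> 1/2"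
  shows "spring_mass_solution \<alpha> \<theta>\<^sub>d L\<^sub>d \<epsilon> T L \<theta>"
proof -
  define \<omega>' where "\<omega>' = strained_freq \<theta>\<^sub>d \<epsilon>"
  note sol = sol[unfolded clamped_solution_def Let_def \<omega>'_def[symmetric]]
  define L2 \<theta>1 p1 \<theta>2 where defs: "L2 \<tau> = (1 - L \<tau> - \<epsilon>\<^sup>2 * cos (\<theta> \<tau>)) / \<omega>'\<^sup>2 + (p \<tau>)\<^sup>2 / L \<tau> ^ 3"
    "\<theta>1 \<tau> = p \<tau> / (L \<tau>)\<^sup>2" "p1 \<tau> = \<epsilon>\<^sup>2 / \<omega>'\<^sup>2 * L \<tau> * sin (\<theta> \<tau>)"
    "\<theta>2 \<tau> = p1 \<tau> / (L \<tau>)\<^sup>2 - 2 * p \<tau> * y \<tau> / L \<tau> ^ 3" for \<tau>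
  show ?thesis
    unfolding spring_mass_solution_def Let_def \<omega>'_def[symmetric]
  proof (rule exI[of _ y], rule exI[of _ L2], rule exI[of _ \<theta>1], rule exI[of _ \<theta>2], intro conjI ballI)
    fix \<tau> assume \<tau>: "\<tau> \<in> {0..T}"
    have g: "length_clamp (L \<tau>) = L \<tau>" and L0: "L \<tau> \<noteq> 0"
      using near[OF \<tau>] length_clamp_eq by auto
    have d: "(L has_real_derivative y \<tau>) (at \<tau> within {0..T})"
      "(y has_real_derivative L2 \<tau>) (at \<tau> within {0..T})"
      "(\<theta> has_real_derivative \<theta>1 \<tau>) (at \<tau> within {0..T})"
      "(p has_real_derivative p1 \<tau>) (at \<tau> within {0..T})"
      using bspec[OF conjunct1[OF sol] \<tau>] unfolding defs g by blast+
    show "(L has_real_derivative y \<tau>) (at \<tau> within {0..T})"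
      "(y has_real_derivative L2 \<tau>) (at \<tau> within {0..T})"
      "(\<theta> has_real_derivative \<theta>1 \<tau>) (at \<tau> within {0..T})" by (fact d)+
    have "((\<lambda>\<tau>. p \<tau> / (L \<tau>)\<^sup>2) has_real_derivative
        (p1 \<tau> * (L \<tau>)\<^sup>2 - p \<tau> * (2 * y \<tau> * L \<tau>)) / ((L \<tau>)\<^sup>2 * (L \<tau>)\<^sup>2)) (at \<tau> within {0..T})"
      using DERIV_power[OF d(1), of 2] L0 by (intro DERIV_divide d) (simp_all add: mult_ac)
    also have "(p1 \<tau> * (L \<tau>)\<^sup>2 - p \<tau> * (2 * y \<tau> * L \<tau>)) / ((L \<tau>)\<^sup>2 * (L \<tau>)\<^sup>2) = \<theta>2 \<tau>"
      using L0 by (simp add: defs(4) diff_divide_distrib power2_eq_square power3_eq_cube mult_ac)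
    finally show "(\<theta>1 has_real_derivative \<theta>2 \<tau>) (at \<tau> within {0..T})"
      by (simp add: defs(2)[abs_def])
    have "(\<theta>1 \<tau>)\<^sup>2 * L \<tau> = (p \<tau>)\<^sup>2 / L \<tau> ^ 3"
      using L0 by (simp add: defs(2) power_divide power2_eq_square power3_eq_cube)
    then show "\<omega>'\<^sup>2 * L2 \<tau> + (1 - \<omega>'\<^sup>2 * (\<theta>1 \<tau>)\<^sup>2) * L \<tau> = 1 - \<epsilon>\<^sup>2 * cos (\<theta> \<tau>)"
      using \<omega> unfolding defs(1) \<omega>'_def[symmetric] distrib_left left_diff_distrib by (simp add: mult.assoc)
    have "L \<tau> * \<theta>2 \<tau> + 2 * y \<tau> * \<theta>1 \<tau> = p1 \<tau> / L \<tau>"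
      using L0 by (simp add: defs(2,4) right_diff_distrib power2_eq_square power3_eq_cube)
    also have "\<dots> = \<epsilon>\<^sup>2 / \<omega>'\<^sup>2 * sin (\<theta> \<tau>)"
      using L0 by (simp add: defs(3))
    finally show "L \<tau> * \<theta>2 \<tau> + 2 * y \<tau> * \<theta>1 \<tau> = \<epsilon>\<^sup>2 / \<omega>'\<^sup>2 * sin (\<theta> \<tau>)" .
  qed (use sol in \<open>simp_all add: defs length_clamp_def\<close>)
qed

section \<open>Asymptotic expansion\<close>

text \<open>The bound 3/4 is chosen because its square exceeds 1/2, the lower bound that
  \<open>oscillator_bound\<close> requires of \<omega>^2.\<close>

lemma strained_freq_bounds:
  "\<forall>\<^sub>F \<epsilon> in at_right 0. 3/4 \<le> strained_freq \<theta>\<^sub>d \<epsilon> \<and> strained_freq \<theta>\<^sub>d \<epsilon> \<le> 1"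
proof -
  have "((\<lambda>\<epsilon>. strained_freq \<theta>\<^sub>d \<epsilon>) \<longlongrightarrow> strained_freq \<theta>\<^sub>d 0) (at_right 0)"
    unfolding strained_freq_def by (intro tendsto_intros)
  then have "\<forall>\<^sub>F \<epsilon> in at_right 0. 3/4 < strained_freq \<theta>\<^sub>d \<epsilon>"
    by (rule order_tendstoD(1)) (simp add: strained_freq_def)
  then show ?thesis by (rule eventually_mono) (simp add: strained_freq_def)
qed

lemma strained_freq_square_bounds:
  "\<forall>\<^sub>F \<epsilon> in at_right 0. 1/2 \<le> (strained_freq \<theta>\<^sub>d \<epsilon>)\<^sup>2 \<and> (strained_freq \<theta>\<^sub>d \<epsilon>)\<^sup>2 \<le> 1"
proof (rule eventually_mono[OF strained_freq_bounds])
  fix \<epsilon> assume *: "3/4 \<le> strained_freq \<theta>\<^sub>d \<epsilon> \<and> strained_freq \<theta>\<^sub>d \<epsilon> \<le> 1"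
  then have "(3/4)\<^sup>2 \<le> (strained_freq \<theta>\<^sub>d \<epsilon>)\<^sup>2" by (intro power_mono) auto
  then have "1/2 \<le> (strained_freq \<theta>\<^sub>d \<epsilon>)\<^sup>2" by (simp add: power2_eq_square)
  then show "1/2 \<le> (strained_freq \<theta>\<^sub>d \<epsilon>)\<^sup>2 \<and> (strained_freq \<theta>\<^sub>d \<epsilon>)\<^sup>2 \<le> 1"
    using * by (simp add: power_le_one)
qed

text \<open>Treating all solutions as one indexed family lets a single Landau symbol express
  uniformity over solutions, intervals and times. Functions are therefore written on pairs
  (trajectory, time), even those, like the frequency, that do not depend on time.\<close>

locale clamped_family = parameter_family D e len T
  for D :: "'s set" and e len :: "'s \<Rightarrow> real" and T :: real +
  fixes \<alpha> \<theta>\<^sub>d L\<^sub>d :: real and L y \<theta> p :: "'s \<Rightarrow> real \<Rightarrow> real"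
  assumes sol: "s \<in> D \<Longrightarrow> clamped_solution \<alpha> \<theta>\<^sub>d L\<^sub>d (e s) (len s) (L s) (y s) (\<theta> s) (p s)"
begin

definition \<omega> :: "'s \<times> real \<Rightarrow> real" where "\<omega> x = strained_freq \<theta>\<^sub>d (e (fst x))"
definition g :: "'s \<times> real \<Rightarrow> real" where "g x = length_clamp (L (fst x) (snd x))"
abbreviation E :: "'s \<times> real \<Rightarrow> real" where "E x \<equiv> e (fst x)"
abbreviation at_time :: "('s \<Rightarrow> real \<Rightarrow> real) \<Rightarrow> 's \<times> real \<Rightarrow> real" where
  "at_time f x \<equiv> f (fst x) (snd x)"
definition accel :: "'s \<times> real \<Rightarrow> real" where
  "accel x = (1 - at_time L x - (E x)\<^sup>2 * cos (at_time \<theta> x)) / (\<omega> x)\<^sup>2 + (at_time p x)\<^sup>2 / g x ^ 3"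

lemma eventually_bounds:
  "eventually (\<lambda>x. 3/4 \<le> \<omega> x \<and> \<omega> x \<le> 1 \<and> 1/2 \<le> g x \<and> g x \<le> 3/2) along"
  using eventually_along_param[OF strained_freq_bounds]
  unfolding \<omega>_def g_def by eventually_elim (intro conjI length_clamp_bounds; blast)

lemma derivs:
  assumes "s \<in> D" "\<tau> \<in> {0..len s}"
  shows "(L s has_real_derivative y s \<tau>) (at \<tau> within {0..len s})"
    "(y s has_real_derivative accel (s, \<tau>)) (at \<tau> within {0..len s})"
    "(\<theta> s has_real_derivative p s \<tau> / (g (s, \<tau>))\<^sup>2) (at \<tau> within {0..len s})"
    "(p s has_real_derivative (e s)\<^sup>2 / (\<omega> (s, \<tau>))\<^sup>2 * g (s, \<tau>) * sin (\<theta> s \<tau>)) (at \<tau> within {0..len s})"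
  using bspec[OF conjunct1[OF sol[OF assms(1), unfolded clamped_solution_def Let_def]] assms(2)]
  unfolding accel_def \<omega>_def g_def fst_conv snd_conv by blast+

lemma inits:
  assumes "s \<in> D"
  shows "L s 0 = 1" "y s 0 = - (e s / \<omega> (s, \<tau>) * L\<^sub>d)" "\<theta> s 0 = - \<alpha>" "p s 0 = e s / \<omega> (s, \<tau>) * \<theta>\<^sub>d"
  using sol[OF assms] unfolding clamped_solution_def Let_def \<omega>_def fst_conv by blast+

lemma eventually_inits:
  "eventually (\<lambda>x. L (fst x) 0 = 1 \<and>
     y (fst x) 0 = - (E x / \<omega> x * L\<^sub>d) \<and>
     \<theta> (fst x) 0 = - \<alpha> \<and> p (fst x) 0 = E x / \<omega> x * \<theta>\<^sub>d) along"
  by (rule eventually_mono[OF eventually_in_domain]) (metis inits prod.collapse)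

section \<open>Orders of the elementary factors and of the frequency corrections\<close>

lemma ord_param: "(\<lambda>x. E x ^ n) \<in> ord n" "E \<in> ord 1"
  by (auto simp: bigoI[of _ 1])

lemma ord_trig: "(\<lambda>x. sin (f x)) \<in> ord 0" "(\<lambda>x. cos (f x)) \<in> ord 0"
  by (rule ord_bounded[of _ 1], simp)+

lemma ord_g: "g \<in> ord 0" "(\<lambda>x. 1 / g x) \<in> ord 0"
  by (rule ord_bounded[of _ 2], rule eventually_mono[OF eventually_bounds], simp add: field_simps abs_le_iff)+

lemma ord_inverse_freq_bounded: "(\<lambda>x. 1 / \<omega> x) \<in> ord 0"
  by (rule ord_bounded[of _ 2], rule eventually_mono[OF eventually_bounds], simp add: field_simps abs_le_iff)

lemma ord_freq_bounded: "\<omega> \<in> ord 0"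
  by (rule ord_bounded[of _ 1], rule eventually_mono[OF eventually_bounds], simp)

lemma ord_freq: "(\<lambda>x. \<omega> x - 1) \<in> ord 2"
  unfolding \<omega>_def strained_freq_def
  using ord_mult[OF ord_const ord_param(1), of 2 2 "- (\<theta>\<^sub>d\<^sup>2 / 2)"] by simp

lemma ord_freq_square: "(\<lambda>x. (\<omega> x)\<^sup>2 - 1) \<in> ord 2"
proof -
  have "(\<lambda>x. (\<omega> x - 1) * (\<omega> x + 1)) \<in> ord 2"
    by (rule ord_mult[OF ord_freq sum_in_bigo(1)[OF ord_freq_bounded ord_const]]) simp
  then show ?thesis by (simp add: algebra_simps power2_eq_square)
qed

lemma ord_inverse_freq: "(\<lambda>x. 1 / \<omega> x - 1) \<in> ord 2"
proof (rule ord_cong)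
  show "eventually (\<lambda>x. 1 / \<omega> x - 1 = - ((\<omega> x - 1) * (1 / \<omega> x))) along"
    by (rule eventually_mono[OF eventually_bounds]) (simp add: field_simps)
  show "(\<lambda>x. - ((\<omega> x - 1) * (1 / \<omega> x))) \<in> ord 2"
    unfolding landau_o.big.uminus_in_iff by (rule ord_mult[OF ord_freq ord_inverse_freq_bounded]) simp
qed

lemma ord_inverse_freq_square: "(\<lambda>x. 1 / (\<omega> x)\<^sup>2 - 1) \<in> ord 2"
proof (rule ord_cong)
  show "eventually (\<lambda>x. 1 / (\<omega> x)\<^sup>2 - 1 = (1 / \<omega> x - 1) * (1 / \<omega> x + 1)) along"
    by (rule eventually_mono[OF eventually_bounds]) (simp add: field_simps power2_eq_square)
  show "(\<lambda>x. (1 / \<omega> x - 1) * (1 / \<omega> x + 1)) \<in> ord 2"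
    by (rule ord_mult[OF ord_inverse_freq sum_in_bigo(1)[OF ord_inverse_freq_bounded ord_const]]) simp
qed

section \<open>First-order estimates for momentum, angle and length\<close>

text \<open>The derivative of p carries the factor \<epsilon>^2, and its initial value differs from
  \<epsilon> \<open>\<theta>\<^sub>d\<close> only by the correction 1 / \<omega> - 1, which is
  itself of second order.\<close>

lemma ord_p_minus: "(\<lambda>x. at_time p x - E x * \<theta>\<^sub>d) \<in> ord 2"
proof (rule ord_integrate[where f = "\<lambda>s \<tau>. p s \<tau> - e s * \<theta>\<^sub>d"])
  fix s \<tau> assume *: "s \<in> D" "\<tau> \<in> {0..len s}"
  show "((\<lambda>\<tau>. p s \<tau> - e s * \<theta>\<^sub>d) has_real_derivative
     (\<lambda>x. E x ^ 2 * ((1 / \<omega> x * (1 / \<omega> x)) * (g x * sin (at_time \<theta> x)))) (s, \<tau>)) (at \<tau> within {0..len s})"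
    by (rule derivative_eq_intros derivs[OF *] refl)+ (simp add: power2_eq_square)
next
  show "(\<lambda>x. E x ^ 2 * ((1 / \<omega> x * (1 / \<omega> x)) * (g x * sin (at_time \<theta> x)))) \<in> ord 2"
    by (rule ord_mult[where m=2 and n=0] ord_mult[where m=0 and n=0] ord_param
        ord_inverse_freq_bounded ord_g ord_trig le_refl | simp)+
next
  show "(\<lambda>x. p (fst x) 0 - E x * \<theta>\<^sub>d) \<in> ord 2"
  proof (rule ord_cong)
    show "eventually (\<lambda>x. p (fst x) 0 - E x * \<theta>\<^sub>d = E x ^ 1 * ((1 / \<omega> x - 1) * \<theta>\<^sub>d)) along"
      using eventually_inits by eventually_elim (simp add: algebra_simps)
    show "(\<lambda>x. E x ^ 1 * ((1 / \<omega> x - 1) * \<theta>\<^sub>d)) \<in> ord 2"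
      by (rule ord_mult[where m=1 and n=2] ord_mult[where m=2 and n=0] ord_param ord_inverse_freq ord_const | simp)+
  qed
qed

lemma ord_p: "at_time p \<in> ord 1"
proof -
  have "(\<lambda>x. E x * \<theta>\<^sub>d) \<in> ord 1" by (rule ord_mult[OF ord_param(2) ord_const]) simp
  from sum_in_bigo(1)[OF ord_mono[OF ord_p_minus] this] show ?thesis by simp
qed

lemma ord_angle: "(\<lambda>x. at_time \<theta> x + \<alpha>) \<in> ord 1"
proof (rule ord_integrate[where f = "\<lambda>s \<tau>. \<theta> s \<tau> + \<alpha>"])
  fix s \<tau> assume *: "s \<in> D" "\<tau> \<in> {0..len s}"
  show "((\<lambda>\<tau>. \<theta> s \<tau> + \<alpha>) has_real_derivative
     (\<lambda>x. at_time p x * (1 / g x * (1 / g x))) (s, \<tau>)) (at \<tau> within {0..len s})"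
    by (rule derivative_eq_intros derivs[OF *] refl)+ (simp add: power2_eq_square)
next
  show "(\<lambda>x. at_time p x * (1 / g x * (1 / g x))) \<in> ord 1"
    by (rule ord_mult[OF ord_p ord_mult[OF ord_g(2) ord_g(2) order_refl]]) simp
next
  show "(\<lambda>x. \<theta> (fst x) 0 + \<alpha>) \<in> ord 1"
    by (rule ord_cong[of _ "\<lambda>_. 0"], rule eventually_mono[OF eventually_inits]) auto
qed

lemma ord_cos_angle: "(\<lambda>x. cos (at_time \<theta> x) - cos \<alpha>) \<in> ord 1"
proof (rule ord_dominated[OF _ ord_angle], rule always_eventually, rule allI)
  show "\<bar>cos (at_time \<theta> x) - cos \<alpha>\<bar> \<le> \<bar>at_time \<theta> x + \<alpha>\<bar>" for x
    using abs_cos_diff_le[of "at_time \<theta> x" "- \<alpha>"] by simp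
qed

lemma ord_sin_angle: "(\<lambda>x. sin (at_time \<theta> x) + sin \<alpha>) \<in> ord 1"
proof (rule ord_dominated[OF _ ord_angle], rule always_eventually, rule allI)
  show "\<bar>sin (at_time \<theta> x) + sin \<alpha>\<bar> \<le> \<bar>at_time \<theta> x + \<alpha>\<bar>" for x
    using abs_sin_diff_le[of "at_time \<theta> x" "- \<alpha>"] by simp
qed

text \<open>Right-hand side of the oscillator equation \<omega>^2 L'' + (L - 1) =
  \<open>forcing\<close>, as \<open>eventually_acceleration\<close> confirms.\<close>

definition forcing :: "'s \<times> real \<Rightarrow> real" where
  "forcing x = - (E x ^ 2 * cos (at_time \<theta> x)) + (\<omega> x)\<^sup>2 * ((at_time p x)\<^sup>2 * (1 / g x) ^ 3)"

lemma ord_inverse_g_power: "(\<lambda>x. (1 / g x) ^ n) \<in> ord 0"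
  using landau_o.big_power[OF ord_g(2), of n] by simp

lemma ord_freq_square_bounded: "(\<lambda>x. (\<omega> x)\<^sup>2) \<in> ord 0"
  using landau_o.big_power[OF ord_freq_bounded, of 2] by simp

lemma ord_p_square: "(\<lambda>x. (at_time p x)\<^sup>2) \<in> ord 2"
  using landau_o.big_power[OF ord_p, of 2] by simp

lemma ord_forcing: "forcing \<in> ord 2"
  unfolding forcing_def[abs_def]
  by (rule sum_in_bigo(1), subst landau_o.big.uminus_in_iff)
    (rule ord_mult[OF ord_param(1) ord_trig(2)]
      ord_mult[OF ord_freq_square_bounded ord_mult[OF ord_p_square ord_inverse_g_power order_refl]] | simp)+

lemma eventually_acceleration:
  "eventually (\<lambda>x. (\<omega> x)\<^sup>2 * accel x = forcing x + 1 - at_time L x) along"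
  using eventually_bounds
proof eventually_elim
  case (elim x)
  then have "\<omega> x \<noteq> 0" by auto
  then show ?case by (simp add: accel_def forcing_def distrib_left power_divide)
qed

text \<open>The forcing is of second order; the first-order size of L - 1 comes from the initial
  velocity.\<close>

lemma ord_length: "(\<lambda>x. at_time L x - 1) \<in> ord 1"
proof (rule ord_oscillator[where M = "\<lambda>s \<tau>. L s \<tau> - 1" and \<omega> = "strained_freq \<theta>\<^sub>d"])
  fix s \<tau> assume *: "s \<in> D" "\<tau> \<in> {0..len s}"
  show "((\<lambda>\<tau>. L s \<tau> - 1) has_real_derivative y s \<tau>) (at \<tau> within {0..len s})"
    by (rule derivative_eq_intros derivs[OF *] refl)+ simp
  show "(y s has_real_derivative accel (s, \<tau>)) (at \<tau> within {0..len s})"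
    by (rule derivs[OF *])
next
  show "(\<lambda>x. (strained_freq \<theta>\<^sub>d (E x))\<^sup>2 * accel (fst x, snd x) + (at_time L x - 1)) \<in> ord 1"
  proof (rule ord_cong[OF _ ord_mono[OF ord_forcing]])
    show "eventually (\<lambda>x. (strained_freq \<theta>\<^sub>d (E x))\<^sup>2 * accel (fst x, snd x) + (at_time L x - 1) = forcing x) along"
      using eventually_acceleration
      unfolding \<omega>_def prod.collapse fst_conv by eventually_elim linarith
  qed simp
next
  show "(\<lambda>x. y (fst x) 0) \<in> ord 1"
  proof (rule ord_cong)
    show "eventually (\<lambda>x. y (fst x) 0 = E x ^ 1 * (1 / \<omega> x * (- L\<^sub>d))) along"
      using eventually_inits by eventually_elim simp
    show "(\<lambda>x. E x ^ 1 * (1 / \<omega> x * (- L\<^sub>d))) \<in> ord 1"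
      by (rule ord_mult[OF ord_param(1) ord_mult[OF ord_inverse_freq_bounded ord_const order_refl]]) simp
  qed
next
  show "\<forall>\<^sub>F \<epsilon> in at_right 0. 1/2 \<le> (strained_freq \<theta>\<^sub>d \<epsilon>)\<^sup>2 \<and> (strained_freq \<theta>\<^sub>d \<epsilon>)\<^sup>2 \<le> 1"
    by (rule strained_freq_square_bounds)
next
  show "L s 0 - 1 = 0" if "s \<in> D" for s
    by (simp add: inits(1)[OF that])
qed

text \<open>Switches the truncation off for small \<epsilon>. The inequality is strict, which is
  what contradicts a first exit in \<open>no_exit\<close>.\<close>

lemma eventually_near: "eventually (\<lambda>x. \<bar>at_time L x - 1\<bar> < 1/2) along"
  by (rule ord_small[OF ord_length]) auto

lemma eventually_g: "eventually (\<lambda>x. g x = at_time L x) along"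
  using eventually_near by eventually_elim (auto simp: g_def intro: length_clamp_eq)

lemma ord_g_minus_one: "(\<lambda>x. g x - 1) \<in> ord 1"
  by (rule ord_cong[OF _ ord_length]) (use eventually_g in eventually_elim, simp)

lemma ord_inverse_g_cube: "(\<lambda>x. (1 / g x) ^ 3 - 1) \<in> ord 1"
proof (rule ord_cong)
  show "eventually (\<lambda>x. (1 / g x) ^ 3 - 1 = (g x - 1) * (- (1 / g x) * ((1 / g x) ^ 2 + 1 / g x + 1))) along"
    by (rule eventually_mono[OF eventually_bounds]) (simp add: field_simps power2_eq_square power3_eq_cube)
  have "(\<lambda>x. - (1 / g x)) \<in> ord 0"
    unfolding landau_o.big.uminus_in_iff by (rule ord_g(2))
  then show "(\<lambda>x. (g x - 1) * (- (1 / g x) * ((1 / g x) ^ 2 + 1 / g x + 1))) \<in> ord 1"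
    by (rule ord_mult[OF ord_g_minus_one ord_mult[OF _
        sum_in_bigo(1)[OF sum_in_bigo(1)[OF ord_inverse_g_power ord_g(2)] ord_const] order_refl]]) simp
qed

section \<open>Third-order error of the length\<close>

text \<open>The factors are replaced by their limits one at a time: \<omega>^2 by 1, 1 / g^3 by 1,
  p^2 by \<epsilon>^2 \<open>\<theta>\<^sub>d\<^sup>2\<close> through a difference of squares, and
  cos \<theta> by cos \<alpha>. Each replacement gains at least one order over \<epsilon>^2.\<close>

lemma ord_forcing_minus: "(\<lambda>x. forcing x + E x ^ 2 * (cos \<alpha> - \<theta>\<^sub>d\<^sup>2)) \<in> ord 3"
proof -
  have eq: "forcing x + E x ^ 2 * (cos \<alpha> - \<theta>\<^sub>d\<^sup>2) =
      ((\<omega> x)\<^sup>2 - 1) * ((at_time p x)\<^sup>2 * (1 / g x) ^ 3) + (at_time p x)\<^sup>2 * ((1 / g x) ^ 3 - 1)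
      + (at_time p x - E x * \<theta>\<^sub>d) * (at_time p x + E x * \<theta>\<^sub>d) - E x ^ 2 * (cos (at_time \<theta> x) - cos \<alpha>)" for x
    unfolding forcing_def by (simp add: algebra_simps power2_eq_square)
  have E\<theta>: "(\<lambda>x. E x * \<theta>\<^sub>d) \<in> ord 1" by (rule ord_mult[OF ord_param(2) ord_const]) simp
  show ?thesis unfolding eq
    by (intro sum_in_bigo ord_mult[OF ord_freq_square ord_mult[OF ord_p_square ord_inverse_g_power order_refl]]
        ord_mult[OF ord_p_square ord_inverse_g_cube] ord_mult[OF ord_p_minus sum_in_bigo(1)[OF ord_p E\<theta>]]
        ord_mult[OF ord_param(1) ord_cos_angle]) simp_all
qed

text \<open>\<open>L_approx\<close> - 1 solves M'' + M = -\<epsilon>^2 A with M(0) = 0 and M'(0) =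
  -\<epsilon> \<open>L\<^sub>d\<close>, so the error is again an oscillator starting at 0, with
  initial velocity of third order.\<close>

lemma length_expansion: "(\<lambda>x. at_time L x - L_approx \<alpha> \<theta>\<^sub>d L\<^sub>d (E x) (snd x)) \<in> ord 3"
proof -
  define A where "A = cos \<alpha> - \<theta>\<^sub>d\<^sup>2"
  define M2 where "M2 s \<tau> = accel (s, \<tau>) - (e s * L\<^sub>d * sin \<tau> - (e s)\<^sup>2 * A * cos \<tau>)" for s \<tau>
  show ?thesis
  proof (rule ord_oscillator[where M = "\<lambda>s \<tau>. L s \<tau> - L_approx \<alpha> \<theta>\<^sub>d L\<^sub>d (e s) \<tau>" and \<omega> = "strained_freq \<theta>\<^sub>d"
        and ?M1.0 = "\<lambda>s \<tau>. y s \<tau> + e s * L\<^sub>d * cos \<tau> + (e s)\<^sup>2 * A * sin \<tau>" and ?M2.0 = M2])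
    fix s \<tau> assume *: "s \<in> D" "\<tau> \<in> {0..len s}"
    show "((\<lambda>\<tau>. L s \<tau> - L_approx \<alpha> \<theta>\<^sub>d L\<^sub>d (e s) \<tau>) has_real_derivative
        y s \<tau> + e s * L\<^sub>d * cos \<tau> + (e s)\<^sup>2 * A * sin \<tau>) (at \<tau> within {0..len s})"
      unfolding L_approx_def A_def[symmetric]
      by (rule derivative_eq_intros derivs[OF *] refl)+ (simp add: algebra_simps)
    show "((\<lambda>\<tau>. y s \<tau> + e s * L\<^sub>d * cos \<tau> + (e s)\<^sup>2 * A * sin \<tau>) has_real_derivative M2 s \<tau>) (at \<tau> within {0..len s})"
      unfolding M2_def
      by (rule derivative_eq_intros derivs[OF *] refl)+ (simp add: algebra_simps)
  next
    \<comment> \<open>This is the residual of the error: the deviation of the forcing from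
      -\<epsilon>^2 A, minus \<omega>^2 - 1 times the second derivative of \<open>L_approx\<close>,
      which is of first order.\<close>
    have "(\<lambda>x. (forcing x + E x ^ 2 * A) - ((\<omega> x)\<^sup>2 - 1) * (E x ^ 1 * (L\<^sub>d * sin (snd x) - E x * A * cos (snd x)))) \<in> ord 3"
    proof (rule sum_in_bigo)
      show "(\<lambda>x. forcing x + E x ^ 2 * A) \<in> ord 3" unfolding A_def by (rule ord_forcing_minus)
      have 1: "(\<lambda>x. L\<^sub>d * sin (snd x)) \<in> ord 0" by (rule ord_mult[OF ord_const ord_trig(1)]) simp
      have "(\<lambda>x. E x * A) \<in> ord 1" by (rule ord_mult[OF ord_param(2) ord_const]) simp
      then have 2: "(\<lambda>x. E x * A * cos (snd x)) \<in> ord 0" by (rule ord_mult[OF _ ord_trig(2)]) simp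
      show "(\<lambda>x. ((\<omega> x)\<^sup>2 - 1) * (E x ^ 1 * (L\<^sub>d * sin (snd x) - E x * A * cos (snd x)))) \<in> ord 3"
        by (rule ord_mult[OF ord_freq_square ord_mult[OF ord_param(1) sum_in_bigo(2)[OF 1 2] order_refl]]) simp
    qed
    then show "(\<lambda>x. (strained_freq \<theta>\<^sub>d (E x))\<^sup>2 * at_time M2 x + (at_time L x - L_approx \<alpha> \<theta>\<^sub>d L\<^sub>d (E x) (snd x))) \<in> ord 3"
    proof (rule ord_cong[rotated])
      show "eventually (\<lambda>x. (strained_freq \<theta>\<^sub>d (E x))\<^sup>2 * at_time M2 x +
          (at_time L x - L_approx \<alpha> \<theta>\<^sub>d L\<^sub>d (E x) (snd x)) =
          (forcing x + E x ^ 2 * A) - ((\<omega> x)\<^sup>2 - 1) * (E x ^ 1 * (L\<^sub>d * sin (snd x) - E x * A * cos (snd x)))) along"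
        using eventually_acceleration
      proof eventually_elim
        case (elim x)
        then show ?case unfolding M2_def L_approx_def A_def[symmetric] \<omega>_def[symmetric] prod.collapse
            right_diff_distrib[of "(\<omega> x)\<^sup>2"]
          by (simp add: algebra_simps power2_eq_square)
      qed
    qed
  next
    show "(\<lambda>x. y (fst x) 0 + E x * L\<^sub>d * cos 0 + (E x)\<^sup>2 * A * sin 0) \<in> ord 3"
    proof (rule ord_cong)
      show "eventually (\<lambda>x. y (fst x) 0 + E x * L\<^sub>d * cos 0 + (E x)\<^sup>2 * A * sin 0 =
          E x ^ 1 * ((1 / \<omega> x - 1) * (- L\<^sub>d))) along"
        using eventually_inits by eventually_elim (simp add: algebra_simps)
      show "(\<lambda>x. E x ^ 1 * ((1 / \<omega> x - 1) * (- L\<^sub>d))) \<in> ord 3"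
        by (rule ord_mult[OF ord_param(1) ord_mult[OF ord_inverse_freq ord_const order_refl]]) simp
    qed
  next
    show "\<forall>\<^sub>F \<epsilon> in at_right 0. 1/2 \<le> (strained_freq \<theta>\<^sub>d \<epsilon>)\<^sup>2 \<and> (strained_freq \<theta>\<^sub>d \<epsilon>)\<^sup>2 \<le> 1"
      by (rule strained_freq_square_bounds)
  next
    show "L s 0 - L_approx \<alpha> \<theta>\<^sub>d L\<^sub>d (e s) 0 = 0" if "s \<in> D" for s
      by (simp add: L_approx_def inits(1)[OF that])
  qed
qed

section \<open>Third-order error of the angle\<close>

text \<open>To leading order p' = -\<epsilon>^2 sin \<alpha>, because \<theta> starts at -\<alpha>.
  The rest is \<epsilon>^2 times the corrections from 1 / \<omega>^2, from g and from sin \<theta>,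
  each at least of first order.\<close>

lemma ord_p_expansion: "(\<lambda>x. at_time p x - E x * \<theta>\<^sub>d + E x ^ 2 * sin \<alpha> * snd x) \<in> ord 3"
proof (rule ord_integrate[where f = "\<lambda>s \<tau>. p s \<tau> - e s * \<theta>\<^sub>d + e s ^ 2 * sin \<alpha> * \<tau>"])
  fix s \<tau> assume *: "s \<in> D" "\<tau> \<in> {0..len s}"
  show "((\<lambda>\<tau>. p s \<tau> - e s * \<theta>\<^sub>d + e s ^ 2 * sin \<alpha> * \<tau>) has_real_derivative
     (\<lambda>x. E x ^ 2 * ((1 / (\<omega> x)\<^sup>2 - 1) * (g x * sin (at_time \<theta> x)) + (g x - 1) * sin (at_time \<theta> x)
        + (sin (at_time \<theta> x) + sin \<alpha>))) (s, \<tau>)) (at \<tau> within {0..len s})"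
    by (rule derivative_eq_intros derivs[OF *] refl)+ (simp add: algebra_simps)
next
  show "(\<lambda>x. E x ^ 2 * ((1 / (\<omega> x)\<^sup>2 - 1) * (g x * sin (at_time \<theta> x)) + (g x - 1) * sin (at_time \<theta> x)
        + (sin (at_time \<theta> x) + sin \<alpha>))) \<in> ord 3"
    by (intro ord_mult[OF ord_param(1), where n=1] sum_in_bigo ord_sin_angle
      ord_mult[OF ord_g_minus_one ord_trig(1)]
      ord_mult[OF ord_inverse_freq_square ord_mult[OF ord_g(1) ord_trig(1) order_refl]]) simp_all
next
  show "(\<lambda>x. p (fst x) 0 - E x * \<theta>\<^sub>d + E x ^ 2 * sin \<alpha> * 0) \<in> ord 3"
  proof (rule ord_cong)
    show "eventually (\<lambda>x. p (fst x) 0 - E x * \<theta>\<^sub>d + E x ^ 2 * sin \<alpha> * 0 = E x ^ 1 * ((1 / \<omega> x - 1) * \<theta>\<^sub>d)) along"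
      using eventually_inits by eventually_elim (simp add: algebra_simps)
    show "(\<lambda>x. E x ^ 1 * ((1 / \<omega> x - 1) * \<theta>\<^sub>d)) \<in> ord 3"
      by (rule ord_mult[OF ord_param(1) ord_mult[OF ord_inverse_freq ord_const order_refl]]) simp
  qed
qed

text \<open>The angle equation multiplies g - 1 by a first-order quantity, so
  \<open>length_expansion\<close> is needed there only up to second order.\<close>

lemma ord_g_expansion: "(\<lambda>x. g x - 1 + E x * L\<^sub>d * sin (snd x)) \<in> ord 2"
proof (rule ord_cong)
  show "eventually (\<lambda>x. g x - 1 + E x * L\<^sub>d * sin (snd x) =
    (at_time L x - L_approx \<alpha> \<theta>\<^sub>d L\<^sub>d (E x) (snd x)) - E x ^ 2 * ((cos \<alpha> - \<theta>\<^sub>d\<^sup>2) * (1 - cos (snd x)))) along"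
    using eventually_g by eventually_elim (simp add: L_approx_def algebra_simps)
  show "(\<lambda>x. (at_time L x - L_approx \<alpha> \<theta>\<^sub>d L\<^sub>d (E x) (snd x)) - E x ^ 2 * ((cos \<alpha> - \<theta>\<^sub>d\<^sup>2) * (1 - cos (snd x)))) \<in> ord 2"
    by (intro sum_in_bigo ord_mono[OF length_expansion]
        ord_mult[OF ord_param(1) ord_mult[OF ord_const sum_in_bigo(2)[OF ord_const ord_trig(2)] order_refl]]) simp_all
qed

lemma angle_expansion: "(\<lambda>x. at_time \<theta> x - theta_approx \<alpha> \<theta>\<^sub>d L\<^sub>d (E x) (snd x)) \<in> ord 3"
proof (rule ord_integrate[where f = "\<lambda>s \<tau>. \<theta> s \<tau> - theta_approx \<alpha> \<theta>\<^sub>d L\<^sub>d (e s) \<tau>"])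
  let ?f' = "\<lambda>x. at_time p x / (g x)\<^sup>2 - (E x * \<theta>\<^sub>d - E x ^ 2 * sin \<alpha> * snd x + 2 * E x ^ 2 * L\<^sub>d * \<theta>\<^sub>d * sin (snd x))"
  fix s \<tau> assume *: "s \<in> D" "\<tau> \<in> {0..len s}"
  show "((\<lambda>\<tau>. \<theta> s \<tau> - theta_approx \<alpha> \<theta>\<^sub>d L\<^sub>d (e s) \<tau>) has_real_derivative ?f' (s, \<tau>)) (at \<tau> within {0..len s})"
    unfolding theta_approx_def
    by (rule derivative_eq_intros derivs[OF *] refl)+ (simp add: algebra_simps)
next
  show "(\<lambda>x. at_time p x / (g x)\<^sup>2 - (E x * \<theta>\<^sub>d - E x ^ 2 * sin \<alpha> * snd x + 2 * E x ^ 2 * L\<^sub>d * \<theta>\<^sub>d * sin (snd x))) \<in> ord 3"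
  proof (rule ord_cong)
    \<comment> \<open>The identity rests on 1 / g^2 = 1 - 2 (g - 1) + (g - 1)^2 (2 g + 1) / g^2. In
      the linear term p is split as \<epsilon> \<open>\<theta>\<^sub>d\<close> plus a second-order
      rest; the leading part -\<epsilon> \<open>L\<^sub>d\<close> sin \<tau> of g - 1 then produces
      the sine term in the derivative of \<open>theta_approx\<close>.\<close>
    show "eventually (\<lambda>x. at_time p x / (g x)\<^sup>2 - (E x * \<theta>\<^sub>d - E x ^ 2 * sin \<alpha> * snd x + 2 * E x ^ 2 * L\<^sub>d * \<theta>\<^sub>d * sin (snd x)) =
      (at_time p x - E x * \<theta>\<^sub>d + E x ^ 2 * sin \<alpha> * snd x)
       - 2 * ((at_time p x - E x * \<theta>\<^sub>d) * (g x - 1) + E x ^ 1 * (\<theta>\<^sub>d * (g x - 1 + E x * L\<^sub>d * sin (snd x))))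
       + at_time p x * ((g x - 1) * ((g x - 1) * ((2 * g x + 1) * (1 / g x) ^ 2)))) along"
      using eventually_bounds
      by eventually_elim (simp add: field_simps power2_eq_square)
    have "(\<lambda>x. 2 * g x) \<in> ord 0" by (rule ord_mult[OF ord_const ord_g(1)]) simp
    then have bdd: "(\<lambda>x. (2 * g x + 1) * (1 / g x) ^ 2) \<in> ord 0"
      by (rule ord_mult[OF sum_in_bigo(1)[OF _ ord_const] ord_inverse_g_power]) simp
    show "(\<lambda>x. (at_time p x - E x * \<theta>\<^sub>d + E x ^ 2 * sin \<alpha> * snd x)
       - 2 * ((at_time p x - E x * \<theta>\<^sub>d) * (g x - 1) + E x ^ 1 * (\<theta>\<^sub>d * (g x - 1 + E x * L\<^sub>d * sin (snd x))))
       + at_time p x * ((g x - 1) * ((g x - 1) * ((2 * g x + 1) * (1 / g x) ^ 2)))) \<in> ord 3"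
      by (intro sum_in_bigo ord_p_expansion ord_mult[OF ord_const, where n=3]
          ord_mult[OF ord_p_minus ord_g_minus_one]
          ord_mult[OF ord_param(1) ord_mult[OF ord_const ord_g_expansion order_refl]]
          ord_mult[OF ord_p ord_mult[OF ord_g_minus_one ord_mult[OF ord_g_minus_one bdd order_refl] order_refl]])
        simp_all
  qed
next
  show "(\<lambda>x. \<theta> (fst x) 0 - theta_approx \<alpha> \<theta>\<^sub>d L\<^sub>d (E x) 0) \<in> ord 3"
    by (rule ord_cong[of _ "\<lambda>_. 0"], rule eventually_mono[OF eventually_inits]) (auto simp: theta_approx_def)
qed

end

section \<open>Uniform bounds and existence for the truncated system\<close>

text \<open>The family consists of all solutions on all intervals [0, S] with S \<le> T, and the
  parameter is a component of the trajectory. Hence neither the constant nor the threshold depends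
  on S or on the solution, as the exit-time argument requires.\<close>

lemma clamped_expansion:
  fixes \<alpha> \<theta>\<^sub>d L\<^sub>d T :: real
  obtains C where "\<forall>\<^sub>F \<epsilon> in at_right 0. \<forall>S L y \<theta> p. 0 \<le> S \<longrightarrow> S \<le> T \<longrightarrow>
      clamped_solution \<alpha> \<theta>\<^sub>d L\<^sub>d \<epsilon> S L y \<theta> p \<longrightarrow> (\<forall>\<tau>\<in>{0..S}. \<bar>L \<tau> - 1\<bar> < 1/2 \<and>
        \<bar>L \<tau> - L_approx \<alpha> \<theta>\<^sub>d L\<^sub>d \<epsilon> \<tau>\<bar> \<le> C * \<epsilon> ^ 3 \<and> \<bar>\<theta> \<tau> - theta_approx \<alpha> \<theta>\<^sub>d L\<^sub>d \<epsilon> \<tau>\<bar> \<le> C * \<epsilon> ^ 3)"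
proof -
  define D where "D = {(\<epsilon>, S, L, y, \<theta>, p). 0 \<le> S \<and> S \<le> T \<and> clamped_solution \<alpha> \<theta>\<^sub>d L\<^sub>d \<epsilon> S L y \<theta> p}"
  interpret clamped_family D fst "\<lambda>s. fst (snd s)" T \<alpha> \<theta>\<^sub>d L\<^sub>d "\<lambda>s. fst (snd (snd s))"
    "\<lambda>s. fst (snd (snd (snd s)))" "\<lambda>s. fst (snd (snd (snd (snd s))))" "\<lambda>s. snd (snd (snd (snd (snd s))))"
    by unfold_locales (auto simp: D_def)
  obtain B where B: "\<forall>\<^sub>F \<epsilon> in at_right 0. \<forall>s\<in>D. fst s = \<epsilon> \<longrightarrow> (\<forall>\<tau>\<in>{0..fst (snd s)}.
      \<bar>fst (snd (snd s)) \<tau> - L_approx \<alpha> \<theta>\<^sub>d L\<^sub>d (fst s) \<tau>\<bar> \<le> B * \<epsilon> ^ 3)"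
    using length_expansion unfolding in_ord_iff fst_conv snd_conv by blast
  obtain C where C: "\<forall>\<^sub>F \<epsilon> in at_right 0. \<forall>s\<in>D. fst s = \<epsilon> \<longrightarrow> (\<forall>\<tau>\<in>{0..fst (snd s)}.
      \<bar>fst (snd (snd (snd (snd s)))) \<tau> - theta_approx \<alpha> \<theta>\<^sub>d L\<^sub>d (fst s) \<tau>\<bar> \<le> C * \<epsilon> ^ 3)"
    using angle_expansion unfolding in_ord_iff fst_conv snd_conv by blast
  have near: "\<forall>\<^sub>F \<epsilon> in at_right 0. \<forall>s\<in>D. fst s = \<epsilon> \<longrightarrow> (\<forall>\<tau>\<in>{0..fst (snd s)}.
      \<bar>fst (snd (snd s)) \<tau> - 1\<bar> < 1/2)"
    using eventually_near unfolding eventually_along fst_conv snd_conv .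
  show thesis
  proof (rule that[of "max B C"])
    from B C near eventually_at_right_less
    show "\<forall>\<^sub>F \<epsilon> in at_right 0. \<forall>S L y \<theta> p. 0 \<le> S \<longrightarrow> S \<le> T \<longrightarrow>
      clamped_solution \<alpha> \<theta>\<^sub>d L\<^sub>d \<epsilon> S L y \<theta> p \<longrightarrow> (\<forall>\<tau>\<in>{0..S}. \<bar>L \<tau> - 1\<bar> < 1/2 \<and>
        \<bar>L \<tau> - L_approx \<alpha> \<theta>\<^sub>d L\<^sub>d \<epsilon> \<tau>\<bar> \<le> max B C * \<epsilon> ^ 3 \<and> \<bar>\<theta> \<tau> - theta_approx \<alpha> \<theta>\<^sub>d L\<^sub>d \<epsilon> \<tau>\<bar> \<le> max B C * \<epsilon> ^ 3)"
    proof (eventually_elim, intro allI impI ballI)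
      fix \<epsilon> S \<tau> :: real and L y \<theta> p
      assume 1: "\<forall>s\<in>D. fst s = \<epsilon> \<longrightarrow> (\<forall>\<tau>\<in>{0..fst (snd s)}.
          \<bar>fst (snd (snd s)) \<tau> - L_approx \<alpha> \<theta>\<^sub>d L\<^sub>d (fst s) \<tau>\<bar> \<le> B * \<epsilon> ^ 3)"
        and 2: "\<forall>s\<in>D. fst s = \<epsilon> \<longrightarrow> (\<forall>\<tau>\<in>{0..fst (snd s)}.
          \<bar>fst (snd (snd (snd (snd s)))) \<tau> - theta_approx \<alpha> \<theta>\<^sub>d L\<^sub>d (fst s) \<tau>\<bar> \<le> C * \<epsilon> ^ 3)"
        and 3: "\<forall>s\<in>D. fst s = \<epsilon> \<longrightarrow> (\<forall>\<tau>\<in>{0..fst (snd s)}. \<bar>fst (snd (snd s)) \<tau> - 1\<bar> < 1/2)"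
        and "0 < \<epsilon>" "0 \<le> S" "S \<le> T" "clamped_solution \<alpha> \<theta>\<^sub>d L\<^sub>d \<epsilon> S L y \<theta> p" and \<tau>: "\<tau> \<in> {0..S}"
      then have "(\<epsilon>, S, L, y, \<theta>, p) \<in> D" by (simp add: D_def)
      note bounds = 1[rule_format, OF this, simplified, of \<tau>] 2[rule_format, OF this, simplified, of \<tau>]
        3[rule_format, OF this, of \<tau>]
      have "B * \<epsilon> ^ 3 \<le> max B C * \<epsilon> ^ 3" "C * \<epsilon> ^ 3 \<le> max B C * \<epsilon> ^ 3"
        using \<open>0 < \<epsilon>\<close> by (simp_all add: mult_right_mono)
      then show "\<bar>L \<tau> - 1\<bar> < 1/2 \<and>
        \<bar>L \<tau> - L_approx \<alpha> \<theta>\<^sub>d L\<^sub>d \<epsilon> \<tau>\<bar> \<le> max B C * \<epsilon> ^ 3 \<and> \<bar>\<theta> \<tau> - theta_approx \<alpha> \<theta>\<^sub>d L\<^sub>d \<epsilon> \<tau>\<bar> \<le> max B C * \<epsilon> ^ 3"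
        using bounds \<tau> by auto
    qed
  qed
qed

text \<open>The left side of the smallness condition in \<open>clamped_solution_exists\<close> tends
  to 0 with \<epsilon>.\<close>

lemma eventually_clamped_solution_exists:
  assumes "0 \<le> T"
  shows "\<forall>\<^sub>F \<epsilon> in at_right 0. \<exists>L y \<theta> p. clamped_solution \<alpha> \<theta>\<^sub>d L\<^sub>d \<epsilon> T L y \<theta> p"
proof -
  let ?f = "\<lambda>\<epsilon>. \<bar>\<epsilon> / strained_freq \<theta>\<^sub>d \<epsilon> * \<theta>\<^sub>d\<bar> + 3/2 * (\<epsilon>\<^sup>2 / (strained_freq \<theta>\<^sub>d \<epsilon>)\<^sup>2) * T"
  have "(?f \<longlongrightarrow> ?f 0) (at_right 0)"
    unfolding strained_freq_def by (intro tendsto_intros) auto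
  then have "\<forall>\<^sub>F \<epsilon> in at_right 0. ?f \<epsilon> < 1"
    by (rule order_tendstoD(2)) simp
  then show ?thesis
    by eventually_elim (rule clamped_solution_exists[OF assms less_imp_le refl])
qed

section \<open>Solutions of the original system\<close>

text \<open>Continuity argument: if the bound failed, the intermediate value theorem would give
  times with |L - 1| = 1/2. These form a closed set, so there is a first one; up to it the weak
  bound holds, again by the intermediate value theorem, and \<open>improve\<close> makes the bound
  strict there, a contradiction.\<close>

lemma no_exit:
  fixes L :: "real \<Rightarrow> real"
  assumes cont: "continuous_on {0..T} L" and L0: "\<bar>L 0 - 1\<bar> < 1/2"
    and improve: "\<And>S. 0 \<le> S \<Longrightarrow> S \<le> T \<Longrightarrow> \<forall>\<tau>\<in>{0..S}. \<bar>L \<tau> - 1\<bar> \<le> 1/2 \<Longrightarrow> \<bar>L S - 1\<bar> < 1/2"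
    and t: "t \<in> {0..T}"
  shows "\<bar>L t - 1\<bar> < 1/2"
proof (rule ccontr)
  assume neg: "\<not> \<bar>L t - 1\<bar> < 1/2"
  define Z where "Z = {x \<in> {0..T}. \<bar>L x - 1\<bar> = 1/2}"
  have contZ: "continuous_on {0..s} (\<lambda>x. \<bar>L x - 1\<bar>)" if "s \<le> T" for s
    using that by (intro continuous_intros continuous_on_subset[OF cont]) auto
  have exZ: "\<exists>z\<in>Z. z \<le> s" if s: "s \<in> {0..T}" "1/2 \<le> \<bar>L s - 1\<bar>" for s
  proof -
    obtain z where "0 \<le> z" "z \<le> s" "\<bar>L z - 1\<bar> = 1/2"
      using IVT'[of "\<lambda>x. \<bar>L x - 1\<bar>" 0 "1/2" s] L0 s contZ[of s] by auto
    then show ?thesis using s by (auto simp: Z_def)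
  qed
  have "Z \<noteq> {}" using exZ[OF t] neg by auto
  moreover have "closed Z"
    unfolding Z_def by (intro continuous_closed_preimage_constant contZ) auto
  moreover have "bdd_below Z" by (auto simp: Z_def bdd_below_def)
  ultimately have inf: "Inf Z \<in> Z" by (intro closed_contains_Inf)
  have "\<bar>L x - 1\<bar> \<le> 1/2" if x: "x \<in> {0..Inf Z}" for x
  proof (rule ccontr)
    assume "\<not> \<bar>L x - 1\<bar> \<le> 1/2"
    moreover have "x \<in> {0..T}" using x inf by (auto simp: Z_def)
    ultimately obtain z where "z \<in> Z" "z \<le> x" using exZ[of x] by auto
    then have "Inf Z \<le> z" by (intro cInf_lower \<open>bdd_below Z\<close>)
    then have "x = Inf Z" using \<open>z \<le> x\<close> x by auto
    then show False using inf \<open>\<not> \<bar>L x - 1\<bar> \<le> 1/2\<close> by (auto simp: Z_def)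
  qed
  then have "\<bar>L (Inf Z) - 1\<bar> < 1/2" using improve[of "Inf Z"] inf by (auto simp: Z_def)
  then show False using inf by (simp add: Z_def)
qed

text \<open>Existence is part of the conclusion because the estimate alone would hold vacuously
  without solutions. Uniformity lies in the order of quantifiers: C precedes \<epsilon>, the
  solution and the time.\<close>

theorem theorem1:
  fixes \<alpha> \<theta>\<^sub>d L\<^sub>d T :: real
  assumes "0 \<le> T"
  shows "(\<forall>\<^sub>F \<epsilon> in at_right 0. \<exists>L \<theta>. spring_mass_solution \<alpha> \<theta>\<^sub>d L\<^sub>d \<epsilon> T L \<theta>) \<and>
    (\<exists>C. \<forall>\<^sub>F \<epsilon> in at_right 0. \<forall>L \<theta>. spring_mass_solution \<alpha> \<theta>\<^sub>d L\<^sub>d \<epsilon> T L \<theta> \<longrightarrow>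
       (\<forall>\<tau>\<in>{0..T}. \<bar>L \<tau> - L_approx \<alpha> \<theta>\<^sub>d L\<^sub>d \<epsilon> \<tau>\<bar> \<le> C * \<epsilon> ^ 3 \<and>
                   \<bar>\<theta> \<tau> - theta_approx \<alpha> \<theta>\<^sub>d L\<^sub>d \<epsilon> \<tau>\<bar> \<le> C * \<epsilon> ^ 3))"
proof -
  obtain C where C: "\<forall>\<^sub>F \<epsilon> in at_right 0. \<forall>S L y \<theta> p. 0 \<le> S \<longrightarrow> S \<le> T \<longrightarrow>
      clamped_solution \<alpha> \<theta>\<^sub>d L\<^sub>d \<epsilon> S L y \<theta> p \<longrightarrow> (\<forall>\<tau>\<in>{0..S}. \<bar>L \<tau> - 1\<bar> < 1/2 \<and>
        \<bar>L \<tau> - L_approx \<alpha> \<theta>\<^sub>d L\<^sub>d \<epsilon> \<tau>\<bar> \<le> C * \<epsilon> ^ 3 \<and> \<bar>\<theta> \<tau> - theta_approx \<alpha> \<theta>\<^sub>d L\<^sub>d \<epsilon> \<tau>\<bar> \<le> C * \<epsilon> ^ 3)"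
    using clamped_expansion by blast
  have freq: "\<forall>\<^sub>F \<epsilon> in at_right 0. strained_freq \<theta>\<^sub>d \<epsilon> \<noteq> 0"
    by (rule eventually_mono[OF strained_freq_bounds[of \<theta>\<^sub>d]]) auto
  have "\<forall>\<^sub>F \<epsilon> in at_right 0. \<exists>L \<theta>. spring_mass_solution \<alpha> \<theta>\<^sub>d L\<^sub>d \<epsilon> T L \<theta>"
    using C freq eventually_clamped_solution_exists[OF assms, of \<alpha> \<theta>\<^sub>d L\<^sub>d]
  proof eventually_elim
    case (elim \<epsilon>)
    then obtain L y \<theta> p where *: "clamped_solution \<alpha> \<theta>\<^sub>d L\<^sub>d \<epsilon> T L y \<theta> p" by blast
    have "\<bar>L \<tau> - 1\<bar> < 1/2" if "\<tau> \<in> {0..T}" for \<tau>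
      using elim(1) assms * that by blast
    then have "spring_mass_solution \<alpha> \<theta>\<^sub>d L\<^sub>d \<epsilon> T L \<theta>"
      by (intro clamped_imp_spring_mass[OF * elim(2)] less_imp_le)
    then show ?case by blast
  qed
  moreover have "\<forall>\<^sub>F \<epsilon> in at_right 0. \<forall>L \<theta>. spring_mass_solution \<alpha> \<theta>\<^sub>d L\<^sub>d \<epsilon> T L \<theta> \<longrightarrow>
       (\<forall>\<tau>\<in>{0..T}. \<bar>L \<tau> - L_approx \<alpha> \<theta>\<^sub>d L\<^sub>d \<epsilon> \<tau>\<bar> \<le> C * \<epsilon> ^ 3 \<and>
                   \<bar>\<theta> \<tau> - theta_approx \<alpha> \<theta>\<^sub>d L\<^sub>d \<epsilon> \<tau>\<bar> \<le> C * \<epsilon> ^ 3)"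
    using C freq
  proof (eventually_elim, intro allI impI)
    fix \<epsilon> L \<theta>
    assume bounds: "\<forall>S L y \<theta> p. 0 \<le> S \<longrightarrow> S \<le> T \<longrightarrow>
      clamped_solution \<alpha> \<theta>\<^sub>d L\<^sub>d \<epsilon> S L y \<theta> p \<longrightarrow> (\<forall>\<tau>\<in>{0..S}. \<bar>L \<tau> - 1\<bar> < 1/2 \<and>
        \<bar>L \<tau> - L_approx \<alpha> \<theta>\<^sub>d L\<^sub>d \<epsilon> \<tau>\<bar> \<le> C * \<epsilon> ^ 3 \<and> \<bar>\<theta> \<tau> - theta_approx \<alpha> \<theta>\<^sub>d L\<^sub>d \<epsilon> \<tau>\<bar> \<le> C * \<epsilon> ^ 3)"
      and freq: "strained_freq \<theta>\<^sub>d \<epsilon> \<noteq> 0" and sol: "spring_mass_solution \<alpha> \<theta>\<^sub>d L\<^sub>d \<epsilon> T L \<theta>"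
    \<comment> \<open>As long as the weak length bound holds on [0, S], the restriction to [0, S]
      solves the truncated system, and the uniform expansion returns the strict bound at S.\<close>
    have near: "\<bar>L t - 1\<bar> < 1/2" if "t \<in> {0..T}" for t
    proof (rule no_exit[OF _ _ _ that])
      obtain L1 where "\<forall>\<tau>\<in>{0..T}. (L has_real_derivative L1 \<tau>) (at \<tau> within {0..T})" "L 0 = 1"
        using sol unfolding spring_mass_solution_def Let_def by blast
      then show "continuous_on {0..T} L" "\<bar>L 0 - 1\<bar> < 1/2"
        by (auto simp: continuous_on_eq_continuous_within intro: DERIV_continuous)
      fix S assume S: "0 \<le> S" "S \<le> T" "\<forall>\<tau>\<in>{0..S}. \<bar>L \<tau> - 1\<bar> \<le> 1/2"
      then obtain y p where "clamped_solution \<alpha> \<theta>\<^sub>d L\<^sub>d \<epsilon> S L y \<theta> p"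
        using spring_mass_imp_clamped[OF sol freq, of S] by blast
      then show "\<bar>L S - 1\<bar> < 1/2" using bounds S by (meson atLeastAtMost_iff order_refl)
    qed
    then obtain y p where "clamped_solution \<alpha> \<theta>\<^sub>d L\<^sub>d \<epsilon> T L y \<theta> p"
      using spring_mass_imp_clamped[OF sol freq assms order_refl] less_imp_le by metis
    then show "\<forall>\<tau>\<in>{0..T}. \<bar>L \<tau> - L_approx \<alpha> \<theta>\<^sub>d L\<^sub>d \<epsilon> \<tau>\<bar> \<le> C * \<epsilon> ^ 3 \<and>
                   \<bar>\<theta> \<tau> - theta_approx \<alpha> \<theta>\<^sub>d L\<^sub>d \<epsilon> \<tau>\<bar> \<le> C * \<epsilon> ^ 3"
      using bounds assms by blast
  qed
  ultimately show ?thesis by blast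
qed

end
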